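(* Consider the periodic Hamiltonian $$H=-\frac{d^2}{dx^2}+A\sum_{n}\delta(x-nL),$$ where the sum is over all integers. 1) If $L$ and $n$ are fixed and $A\to\infty$, then the bands $b_n$ of $H$ have the form $$b_n=[\omega_{2n-1},\omega_{2n}]=\left[\frac{n\pi}{L}\left(1-\frac{4}{AL}+O(A^{-2})\right),\ \frac{n\pi}{L}\right],\qquad n=1,2,\dots .$$ 2) The group velocity $V_g(\omega)=L/k'(\omega)$ on each band $b_n$ has the estimate $$|V_g(\omega)|\le\frac{2n\pi}{AL}(1+O(A^{-1})),\qquad A\to\infty .$$ 3) The absolute value of the transmission coefficient $t_N(\omega)$ for the potential truncated to $N$ periods is, for $\omega\in b_n$, equal to $$|t_N(\omega)|=\frac{1}{\sqrt{1+\left|A\frac{\sin Nk(\omega)}{2\omega\sin k(\omega)}\right|^2}},$$ and it has the order $O(A^{-1})$ for all $\omega\in b_n$, $n\ge1$, except for very narrow (of order $O(A^{-2})$) neighborhoods of the $N-1$ transparency points where $$\sin Nk(\omega)=0,\qquad \sin k(\omega)\ne0 .$$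
   Context: $\delta$ is the Dirac delta function. Let $M_\omega$ be the Prüfer monodromy matrix of $H$ over one period, i.e. the matrix mapping $(\psi,\psi'/\omega)^T$ at $x=0^-$ to $(\psi,\psi'/\omega)^T$ at $x=L^-$ for every solution $\psi$ of $H\psi=\omega^2\psi$, and let $F(\omega)=\frac12\operatorname{Tr}M_\omega$. The eigenvalues of $M_\omega$ are $e^{\pm ik(\omega)}$, so $\cos k(\omega)=F(\omega)$, where the dispersion relation $k(\omega)$ is analytic with $\operatorname{Im}k(\omega)>0$ for $\operatorname{Im}\omega>0$, and for real $\omega\ge0$ it is defined by continuity from the upper half plane. The bands $b_n=[\omega_{2n-1},\omega_{2n}]$, $n=1,2,\dots$, are the spectral bands on the frequency axis $\omega\ge0$ (energy $\lambda=\omega^2$), i.e. the intervals forming the set $\{|F(\omega)|\le1\}$. The truncated operator is $H_N=-\frac{d^2}{dx^2}+A\sum_{n=0}^{N-1}\delta(x-nL)$. The scattering solution of $H_N\psi=\omega^2\psi$ satisfies $\psi=e^{i\omega x}+r_Ne^{-i\omega x}$ for $x<0$ and $\psi=t_Ne^{i\omega x}$ for $x>NL$; $t_N=t_N(\omega)$ is the transmission coefficient. The ratio $\sin Nk/\sin k$ is understood by continuity where $\sin k=0$.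
   Formalization: A uniform O(1/A) for |t_N| off O(A^-2) neighborhoods of the transparency points fails (e.g. N=2); instead: at each fixed relative band position, O(1/A) or within D/A^2 of such a point; and |t_N| ≤ C(1/A+1/D) off D/A^2 neighborhoods, with constants for fixed L, n, N. *)

theory Defs
  imports "HOL-Analysis.Analysis" "HOL-Library.Landau_Symbols"
begin

text \<open>
  \<^term>\<open>delta_solution A P E \<psi>\<close> says that \<open>- \<psi>'' + A (\<Sum>p\<in>P. \<delta>(x - p)) \<psi> = E \<psi>\<close> on the real line,
  for a closed discrete set \<open>P\<close>. As usual for point interactions this means: \<open>\<psi>\<close> is continuous,
  \<open>- \<psi>'' = E \<psi>\<close> off \<open>P\<close>, and \<open>\<psi>'(p+) - \<psi>'(p-) = A \<psi>(p)\<close> at each \<open>p \<in> P\<close>.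
\<close>

definition delta_solution :: "real \<Rightarrow> real set \<Rightarrow> complex \<Rightarrow> (real \<Rightarrow> complex) \<Rightarrow> bool" where
  "delta_solution A P E \<psi> \<longleftrightarrow>
     continuous_on UNIV \<psi> \<and>
     (\<exists>\<psi>'.
       (\<forall>x. x \<notin> P \<longrightarrow>
          (\<psi> has_vector_derivative \<psi>' x) (at x) \<and>
          (\<psi>' has_vector_derivative - (E * \<psi> x)) (at x)) \<and>
       (\<forall>p\<in>P. \<exists>l r. (\<psi>' \<longlongrightarrow> l) (at_left p) \<and> (\<psi>' \<longlongrightarrow> r) (at_right p) \<and>
          r - l = complex_of_real A * \<psi> p))"

definition lattice :: "real \<Rightarrow> real set" where
  "lattice L = range (\<lambda>n::int. of_int n * L)"

definition truncated_lattice :: "real \<Rightarrow> nat \<Rightarrow> real set" where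
  "truncated_lattice L N = (\<lambda>n. real n * L) ` {..<N}"

text \<open>The vector \<open>(\<psi>, \<psi>'/\<omega>)\<close> at \<open>x-\<close>.\<close>

definition pruefer_data :: "complex \<Rightarrow> (real \<Rightarrow> complex) \<Rightarrow> real \<Rightarrow> complex ^ 2" where
  "pruefer_data \<omega> \<psi> x =
     vector [Lim (at_left x) \<psi>, Lim (at_left x) (\<lambda>y. vector_derivative \<psi> (at y)) / \<omega>]"

definition monodromy :: "real \<Rightarrow> real \<Rightarrow> complex \<Rightarrow> complex ^ 2 ^ 2" where
  "monodromy A L \<omega> =
     (THE M. \<forall>\<psi>. delta_solution A (lattice L) (\<omega>\<^sup>2) \<psi> \<longrightarrow>
        pruefer_data \<omega> \<psi> L = M *v pruefer_data \<omega> \<psi> 0)"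

text \<open>The vector \<open>(\<psi>, \<psi>'/\<omega>)\<close> makes no sense at \<open>\<omega> = 0\<close>; there half the trace is taken by continuity.\<close>

definition half_trace :: "real \<Rightarrow> real \<Rightarrow> complex \<Rightarrow> complex" where
  "half_trace A L \<omega> =
     (if \<omega> = 0 then Lim (at 0) (\<lambda>z. trace (monodromy A L z) / 2)
      else trace (monodromy A L \<omega>) / 2)"

text \<open>
  The dispersion relation is determined up to an additive constant in \<open>2\<pi>\<int>\<close>, which affects neither
  the group velocity nor \<open>\<bar>sin (N k) / sin k\<bar>\<close>; hence a predicate.
\<close>

definition dispersion_relation :: "real \<Rightarrow> real \<Rightarrow> (complex \<Rightarrow> complex) \<Rightarrow> bool" where
  "dispersion_relation A L k \<longleftrightarrow>
     k holomorphic_on {z. Im z > 0} \<and>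
     (\<forall>z. Im z > 0 \<longrightarrow> Im (k z) > 0 \<and> cos (k z) = half_trace A L z) \<and>
     (\<forall>x\<ge>0. (k \<longlongrightarrow> k (complex_of_real x)) (at (complex_of_real x) within {z. Im z > 0}))"

definition band_set :: "real \<Rightarrow> real \<Rightarrow> real set" where
  "band_set A L = {\<omega>. 0 \<le> \<omega> \<and> cmod (half_trace A L (complex_of_real \<omega>)) \<le> 1}"

text \<open>The \<open>n\<close>-th band, \<open>n \<ge> 1\<close>: the component that has exactly \<open>n - 1\<close> components below it.\<close>

definition band :: "real \<Rightarrow> real \<Rightarrow> nat \<Rightarrow> real set" where
  "band A L n =
     (THE B. B \<in> components (band_set A L) \<and>
        finite {C \<in> components (band_set A L). \<forall>x\<in>C. \<forall>y\<in>B. x < y} \<and>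
        card {C \<in> components (band_set A L). \<forall>x\<in>C. \<forall>y\<in>B. x < y} = n - 1)"

definition dispersion_deriv :: "(complex \<Rightarrow> complex) \<Rightarrow> real \<Rightarrow> complex" where
  "dispersion_deriv k \<omega> = vector_derivative (\<lambda>x. k (complex_of_real x)) (at \<omega>)"

text \<open>
  Group velocity \<open>L / k'(\<omega>)\<close> on a band \<open>B\<close>. At the band edges \<open>k'\<close> is infinite, and the group
  velocity is taken by continuity from inside the band.
\<close>

definition group_velocity :: "real \<Rightarrow> (complex \<Rightarrow> complex) \<Rightarrow> real set \<Rightarrow> real \<Rightarrow> complex" where
  "group_velocity L k B \<omega> =
     (if \<omega> \<in> interior B then complex_of_real L / dispersion_deriv k \<omega>
      else Lim (at \<omega> within interior B) (\<lambda>x. complex_of_real L / dispersion_deriv k x))"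

definition transmission :: "real \<Rightarrow> real \<Rightarrow> nat \<Rightarrow> real \<Rightarrow> complex" where
  "transmission A L N \<omega> =
     (THE t. \<exists>r \<psi>. delta_solution A (truncated_lattice L N) (complex_of_real \<omega> ^ 2) \<psi> \<and>
        (\<forall>x<0. \<psi> x = exp (\<i> * of_real \<omega> * of_real x) + r * exp (- \<i> * of_real \<omega> * of_real x)) \<and>
        (\<forall>x>real N * L. \<psi> x = t * exp (\<i> * of_real \<omega> * of_real x)))"

text \<open>\<open>sin (N z) / sin z\<close>, by continuity where \<open>sin z = 0\<close>.\<close>

definition sin_ratio :: "nat \<Rightarrow> complex \<Rightarrow> complex" where
  "sin_ratio N z =
     (if sin z = 0 then Lim (at z) (\<lambda>w. sin (of_nat N * w) / sin w)
      else sin (of_nat N * z) / sin z)"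

definition transparency_points :: "(complex \<Rightarrow> complex) \<Rightarrow> real set \<Rightarrow> nat \<Rightarrow> real set" where
  "transparency_points k B N =
     {\<omega> \<in> B. sin (of_nat N * k (complex_of_real \<omega>)) = 0 \<and> sin (k (complex_of_real \<omega>)) \<noteq> 0}"

text \<open>The bands move with \<open>A\<close>; a fixed \<open>s \<in> [0, 1]\<close> singles out a relative position in it.\<close>

definition band_point :: "real set \<Rightarrow> real \<Rightarrow> real" where
  "band_point B s = Inf B + s * (Sup B - Inf B)"

end

theory Submission
  imports Defs
begin

text \<open>
  On a cell the solutions are waves \<open>\<alpha> cos + \<beta> sin\<close>, so the monodromy matrix is explicit and
  \<open>F(\<omega>) = cos \<theta> + (a / \<theta>) sin \<theta>\<close> with \<open>\<theta> = \<omega> L\<close> and \<open>a = A L / 2\<close>. Writing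
  \<open>\<theta> = n \<pi> - d\<close> with \<open>0 \<le> d < \<pi>\<close>, half-angle formulas turn \<open>\<bar>F\<bar> \<le> 1\<close> into
  \<open>a sin (d/2) \<le> (n \<pi> - d) cos (d/2)\<close>, i.e. \<open>d \<le> d\<^sub>n\<close> where \<open>d\<^sub>n = 2 n \<pi> / a + O(a\<^sup>-\<^sup>2)\<close>;
  on the band, \<open>F\<close> is monotone from \<open>\<plusminus>1\<close> to \<open>\<mp>1\<close> with slope of order \<open>a\<close> in \<open>\<theta>\<close>.

  The group velocity is \<open>- sin k / F'(\<theta>)\<close>, and \<open>sin\<^sup>2 k = 1 - F\<^sup>2 \<le> 1\<close>.

  By Cayley-Hamilton \<open>M\<^sup>N = U\<^sub>N(F) M - U\<^sub>N\<^sub>-\<^sub>1(F)\<close> with the Chebyshev polynomials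
  \<open>U\<^sub>N(cos k) = sin N k / sin k\<close>, which gives the transmission coefficient as a function of
  \<open>U\<^sub>N(F)\<close>. The transparency points are the preimages under \<open>F\<close> of the \<open>N - 1\<close> simple roots of
  \<open>U\<^sub>N\<close>, and \<open>\<bar>U\<^sub>N\<bar>\<close> is bounded below by a multiple of the distance to the nearest root.
\<close>

section \<open>Solutions with point interactions and the monodromy matrix\<close>

text \<open>The monodromy matrix and the transmission coefficient are defined as unique objects, so
  uniqueness of continuation is not enough: solutions with arbitrary data at 0 must be constructed
  on the whole line, backwards as well as forwards. About \<open>k\<close> only the identity cos k =
  F in the open half plane and continuity up to its boundary are given. Hence no branch of arccos is
  chosen: sin Nk / sin k enters as a polynomial in F, |sin k| as sqrt (1 - F^2), and k' comes from
  differentiating cos k = F. Monotonicity of F on a band is proved for every a > 0, since the count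
  N - 1 is claimed for every A > 0. As the bands shrink while A grows, the last claim is made
  precise in two ways: at a fixed relative position s, where F tends to (-1)^n (2s - 1) and it
  matters whether this limit is a root of U_N; and uniformly, where the slope of order A turns a
  distance D / A^2 from a transparency point into a difference of order D / A in F.\<close>

text \<open>With the derivative as a parameter, conditions at different points speak about one and
  the same \<open>\<psi>'\<close>.\<close>

definition delta_solution_with ::
  "real \<Rightarrow> real set \<Rightarrow> complex \<Rightarrow> (real \<Rightarrow> complex) \<Rightarrow> (real \<Rightarrow> complex) \<Rightarrow> bool" where
  "delta_solution_with A P E \<psi> \<psi>' \<longleftrightarrow>
     continuous_on UNIV \<psi> \<and>
     (\<forall>x. x \<notin> P \<longrightarrow>
          (\<psi> has_vector_derivative \<psi>' x) (at x) \<and>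
          (\<psi>' has_vector_derivative - (E * \<psi> x)) (at x)) \<and>
     (\<forall>p\<in>P. \<exists>l r. (\<psi>' \<longlongrightarrow> l) (at_left p) \<and> (\<psi>' \<longlongrightarrow> r) (at_right p) \<and>
          r - l = complex_of_real A * \<psi> p)"

lemma delta_solution_iff: "delta_solution A P E \<psi> \<longleftrightarrow> (\<exists>\<psi>'. delta_solution_with A P E \<psi> \<psi>')"
  unfolding delta_solution_def delta_solution_with_def by blast

text \<open>The free solution whose Pruefer data at \<open>p\<close> are
  \<open>(\<alpha>, \<beta>)\<close>. Differentiation multiplies by \<open>\<omega>\<close> and
  turns these coefficients into \<open>(\<beta>, - \<alpha>)\<close>.\<close>

definition wave :: "complex \<Rightarrow> real \<Rightarrow> complex \<Rightarrow> complex \<Rightarrow> real \<Rightarrow> complex" where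
  "wave \<omega> p \<alpha> \<beta> x = \<alpha> * cos (\<omega> * of_real (x - p)) + \<beta> * sin (\<omega> * of_real (x - p))"

lemma has_vector_derivative_wave [derivative_intros]:
  "(wave \<omega> p \<alpha> \<beta> has_vector_derivative \<omega> * wave \<omega> p \<beta> (- \<alpha>) x) (at x)"
proof -
  have "((\<lambda>z. \<alpha> * cos (\<omega> * (z - of_real p)) + \<beta> * sin (\<omega> * (z - of_real p))) has_field_derivative
     \<omega> * wave \<omega> p \<beta> (- \<alpha>) x) (at (of_real x))"
    by (auto intro!: derivative_eq_intros simp: wave_def algebra_simps)
  from has_vector_derivative_real_field[OF this]
  show ?thesis unfolding wave_def by simp
qed

lemma isCont_wave: "isCont (wave \<omega> p \<alpha> \<beta>) x"
  using has_vector_derivative_wave has_vector_derivative_continuous by blast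

lemma tendsto_wave:
  assumes "F \<le> nhds x"
  shows "(wave \<omega> p \<alpha> \<beta> \<longlongrightarrow> wave \<omega> p \<alpha> \<beta> x) F"
proof -
  have "(wave \<omega> p \<alpha> \<beta> \<longlongrightarrow> wave \<omega> p \<alpha> \<beta> x) (nhds x)"
    using isCont_wave continuous_at tendsto_at_iff_tendsto_nhds by blast
  thus ?thesis by (rule tendsto_mono[OF assms])
qed

lemmas tendsto_wave_at = tendsto_wave[OF at_within_le_nhds]

lemma wave_at [simp]: "wave \<omega> p \<alpha> \<beta> p = \<alpha>"
  by (simp add: wave_def)

text \<open>Rebasing a wave at another point, by the addition formulas. This is what allows waves on
  neighbouring cells to be compared at their common lattice point.\<close>

lemma wave_shift:
  "wave \<omega> q (wave \<omega> p \<alpha> \<beta> q) (wave \<omega> p \<beta> (- \<alpha>) q) x = wave \<omega> p \<alpha> \<beta> x"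
proof -
  have e: "\<omega> * of_real (x - p) = \<omega> * of_real (x - q) + \<omega> * of_real (q - p)"
    by (simp add: algebra_simps)
  show ?thesis
    unfolding wave_def e cos_add sin_add by (simp add: algebra_simps)
qed

lemma solution_is_wave:
  assumes sol: "delta_solution_with A P (\<omega>\<^sup>2) \<psi> \<psi>'" and "\<omega> \<noteq> 0" "convex S" "S \<inter> P = {}"
  obtains \<alpha> \<beta> where
    "\<And>x. x \<in> S \<Longrightarrow> \<psi> x = wave \<omega> p \<alpha> \<beta> x" "\<And>x. x \<in> S \<Longrightarrow> \<psi>' x = \<omega> * wave \<omega> p \<beta> (- \<alpha>) x"
proof -
  \<comment> \<open>Rotating \<open>(\<psi>, \<psi>' / \<omega>)\<close> back by the free flow gives
    two quantities with zero derivative; they are the coefficients of the wave.\<close>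
  define f where "f = (\<lambda>x. \<psi> x * wave \<omega> p 1 0 x - \<psi>' x / \<omega> * wave \<omega> p 0 1 x)"
  define g where "g = (\<lambda>x. \<psi> x * wave \<omega> p 0 1 x + \<psi>' x / \<omega> * wave \<omega> p 1 0 x)"
  have w: "wave \<omega> p 0 (-1) x = - wave \<omega> p 0 1 x" for x
    by (simp add: wave_def)
  have d1: "(\<psi> has_vector_derivative \<psi>' x) (at x)"
    and d2: "(\<psi>' has_vector_derivative - (\<omega>\<^sup>2 * \<psi> x)) (at x)" if "x \<in> S" for x
    using that sol assms(4) unfolding delta_solution_with_def by blast+
  have df: "(f has_vector_derivative 0) (at x)" if "x \<in> S" for x
    unfolding f_def
    by (rule derivative_eq_intros d1 d2 that refl has_vector_derivative_divide)+
       (use \<open>\<omega> \<noteq> 0\<close> in \<open>simp add: w field_simps power2_eq_square\<close>)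
  have dg: "(g has_vector_derivative 0) (at x)" if "x \<in> S" for x
    unfolding g_def
    by (rule derivative_eq_intros d1 d2 that refl has_vector_derivative_divide)+
       (use \<open>\<omega> \<noteq> 0\<close> in \<open>simp add: w field_simps power2_eq_square\<close>)
  obtain \<alpha> where \<alpha>: "\<And>x. x \<in> S \<Longrightarrow> f x = \<alpha>"
    by (rule has_vector_derivative_zero_constant[OF \<open>convex S\<close>, of f])
       (use df in \<open>auto intro: has_vector_derivative_at_within\<close>)
  obtain \<beta> where \<beta>: "\<And>x. x \<in> S \<Longrightarrow> g x = \<beta>"
    by (rule has_vector_derivative_zero_constant[OF \<open>convex S\<close>, of g])
       (use dg in \<open>auto intro: has_vector_derivative_at_within\<close>)
  show ?thesis
  proof
    fix x assume x: "x \<in> S"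
    define c where "c = cos (\<omega> * of_real (x - p))"
    define s where "s = sin (\<omega> * of_real (x - p))"
    have cs: "c * c + s * s = 1"
      unfolding c_def s_def using sin_cos_squared_add3 by blast
    have f: "\<psi> x * c - \<psi>' x / \<omega> * s = \<alpha>" and g: "\<psi> x * s + \<psi>' x / \<omega> * c = \<beta>"
      using \<alpha>[OF x] \<beta>[OF x] unfolding f_def g_def wave_def c_def s_def by simp_all
    have "wave \<omega> p \<alpha> \<beta> x = \<psi> x * (c * c + s * s)"
      unfolding wave_def c_def[symmetric] s_def[symmetric] f[symmetric] g[symmetric]
      by (simp add: algebra_simps)
    thus "\<psi> x = wave \<omega> p \<alpha> \<beta> x" by (simp add: cs)
    have "wave \<omega> p \<beta> (- \<alpha>) x = \<psi>' x / \<omega> * (c * c + s * s)"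
      unfolding wave_def c_def[symmetric] s_def[symmetric] f[symmetric] g[symmetric]
      by (simp add: algebra_simps)
    thus "\<psi>' x = \<omega> * wave \<omega> p \<beta> (- \<alpha>) x" using \<open>\<omega> \<noteq> 0\<close> by (simp add: cs)
  qed
qed

text \<open>The data to the right of \<open>p\<close> come from those to the left by adding the
  jump, which is 0 when \<open>p\<close> carries no interaction; continuity at \<open>p\<close> then
  fixes both coefficients. \<open>S\<close> only has to accumulate at \<open>p\<close> from the
  right, so that bounded cells and the half line behind the last interaction are both
  covered.\<close>

lemma solution_wave_right:
  assumes sol: "delta_solution_with A P (\<omega>\<^sup>2) \<psi> \<psi>'" and "\<omega> \<noteq> 0"
    and S: "S \<inter> P = {}" "convex S" "\<And>q. q > p \<Longrightarrow> S \<inter> {p<..<q} \<noteq> {}" "S \<subseteq> {p<..}"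
    and lim: "(\<psi>' \<longlongrightarrow> v) (at_left p)" and "x \<in> S"
  defines "\<beta> \<equiv> (v + of_real (if p \<in> P then A else 0) * \<psi> p) / \<omega>"
  shows "\<psi> x = wave \<omega> p (\<psi> p) \<beta> x \<and> \<psi>' x = \<omega> * wave \<omega> p \<beta> (- \<psi> p) x"
proof -
  have rlim: "(\<psi>' \<longlongrightarrow> \<omega> * \<beta>) (at_right p)"
  proof (cases "p \<in> P")
    case True
    then obtain l r where lr: "(\<psi>' \<longlongrightarrow> l) (at_left p)" "(\<psi>' \<longlongrightarrow> r) (at_right p)"
      "r - l = complex_of_real A * \<psi> p"
      using sol unfolding delta_solution_with_def by blast
    have "l = v" using lr(1) lim by (intro tendsto_unique[of "at_left p"]) auto
    with lr True \<open>\<omega> \<noteq> 0\<close> have "r = \<omega> * \<beta>" by (simp add: \<beta>_def diff_eq_eq add.commute)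
    with lr show ?thesis by simp
  next
    case False
    then have "(\<psi>' has_vector_derivative - (\<omega>\<^sup>2 * \<psi> p)) (at p)"
      using sol unfolding delta_solution_with_def by blast
    then have "isCont \<psi>' p" by (rule has_vector_derivative_continuous)
    then have c: "(\<psi>' \<longlongrightarrow> \<psi>' p) (at p)" by (simp add: isCont_def)
    have "v = \<psi>' p"
      using lim filterlim_mono[OF c order_refl at_le[of "{..<p}" UNIV]]
      by (intro tendsto_unique[of "at_left p"]) auto
    moreover have "(\<psi>' \<longlongrightarrow> \<psi>' p) (at_right p)"
      using filterlim_mono[OF c order_refl at_le[of "{p<..}" UNIV]] by auto
    ultimately show ?thesis using False \<open>\<omega> \<noteq> 0\<close> by (simp add: \<beta>_def)
  qed
  obtain \<alpha> \<gamma> where ag: "\<And>x. x \<in> S \<Longrightarrow> \<psi> x = wave \<omega> p \<alpha> \<gamma> x"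
    "\<And>x. x \<in> S \<Longrightarrow> \<psi>' x = \<omega> * wave \<omega> p \<gamma> (- \<alpha>) x"
    using solution_is_wave[OF sol \<open>\<omega> \<noteq> 0\<close> S(2,1), where p = p] by metis
  have nontriv: "at p within S \<noteq> bot"
    unfolding trivial_limit_within islimpt_approachable
  proof (intro notI, elim notE, intro allI impI)
    fix e :: real assume "e > 0"
    then obtain y where "y \<in> S" "p < y" "y < p + e" using S(3)[of "p + e"] by auto
    thus "\<exists>x'\<in>S. x' \<noteq> p \<and> dist x' p < e" by (auto simp: dist_real_def intro!: bexI[of _ y])
  qed
  have le: "at p within S \<le> at_right p"
    using S(4) by (simp add: at_le)
  have "isCont \<psi> p" using sol unfolding delta_solution_with_def
    by (simp add: continuous_on_eq_continuous_at)
  then have "(\<psi> \<longlongrightarrow> \<psi> p) (at p within S)"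
    using continuous_within_tendsto_compose' isCont_def
    by (metis at_le filterlim_mono order_refl subset_UNIV)
  moreover have "(\<psi> \<longlongrightarrow> wave \<omega> p \<alpha> \<gamma> p) (at p within S)"
    by (rule Lim_transform_within[OF tendsto_wave_at[of \<omega> p \<alpha> \<gamma>], of 1]) (auto simp: ag)
  ultimately have a: "\<alpha> = \<psi> p" using nontriv by (metis tendsto_unique wave_at)
  have "(\<psi>' \<longlongrightarrow> \<omega> * \<beta>) (at p within S)"
    using rlim le by (metis tendsto_mono)
  moreover have "(\<psi>' \<longlongrightarrow> \<omega> * wave \<omega> p \<gamma> (- \<alpha>) p) (at p within S)"
    by (rule Lim_transform_within[OF tendsto_mult[OF tendsto_const tendsto_wave_at[of \<omega> p]], of 1])
       (auto simp: ag)
  ultimately have "\<omega> * \<gamma> = \<omega> * \<beta>" using nontriv by (metis tendsto_unique wave_at)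
  with a ag \<open>x \<in> S\<close> \<open>\<omega> \<noteq> 0\<close> show ?thesis by simp
qed

lemma solution_transfer:
  assumes sol: "delta_solution_with A P (\<omega>\<^sup>2) \<psi> \<psi>'" and "\<omega> \<noteq> 0"
    and "p < q" "{p<..<q} \<inter> P = {}"
    and lim: "(\<psi>' \<longlongrightarrow> v) (at_left p)"
  defines "\<beta> \<equiv> (v + of_real (if p \<in> P then A else 0) * \<psi> p) / \<omega>"
  shows "\<psi> q = wave \<omega> p (\<psi> p) \<beta> q" "(\<psi>' \<longlongrightarrow> \<omega> * wave \<omega> p \<beta> (- \<psi> p) q) (at_left q)"
proof -
  have *: "\<psi> x = wave \<omega> p (\<psi> p) \<beta> x \<and> \<psi>' x = \<omega> * wave \<omega> p \<beta> (- \<psi> p) x" if "x \<in> {p<..<q}" for x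
    unfolding \<beta>_def
  proof (rule solution_wave_right[OF sol \<open>\<omega> \<noteq> 0\<close> _ _ _ _ lim, where S = "{p<..<q}"])
    show "{p<..<q} \<inter> {p<..<q'} \<noteq> {}" if "q' > p" for q'
      using that \<open>p < q\<close> by (simp add: Int_greaterThanLessThan)
  qed (use assms that in auto)
  have ev: "eventually (\<lambda>x. x \<in> {p<..<q}) (at_left q)"
    using \<open>p < q\<close> by (rule eventually_at_left_real)
  have "isCont \<psi> q" using sol unfolding delta_solution_with_def
    by (simp add: continuous_on_eq_continuous_at)
  then have "(\<psi> \<longlongrightarrow> \<psi> q) (at_left q)"
    by (simp add: filterlim_at_split isCont_def)
  moreover have "(\<psi> \<longlongrightarrow> wave \<omega> p (\<psi> p) \<beta> q) (at_left q)"
    by (rule Lim_transform_eventually[OF tendsto_wave_at]) (use ev * in \<open>auto elim: eventually_mono\<close>)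
  ultimately show "\<psi> q = wave \<omega> p (\<psi> p) \<beta> q"
    by (intro tendsto_unique[of "at_left q"]) auto
  show "(\<psi>' \<longlongrightarrow> \<omega> * wave \<omega> p \<beta> (- \<psi> p) q) (at_left q)"
    by (rule Lim_transform_eventually[OF tendsto_mult[OF tendsto_const tendsto_wave_at]])
       (use ev * in \<open>auto elim: eventually_mono\<close>)
qed

section \<open>Existence of solutions with prescribed data at the origin\<close>

text \<open>Forward steps apply \<open>T n\<close>, backward steps a right inverse of it; this is
  where surjectivity enters.\<close>

lemma bi_infinite_orbit:
  fixes T :: "int \<Rightarrow> 'a \<Rightarrow> 'a"
  assumes "\<And>n. surj (T n)"
  obtains u where "u 0 = z" "\<And>n. u (n + 1) = T n (u n)"
proof -
  define f where "f = rec_nat z (\<lambda>m. T (int m))"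
  define g where "g = rec_nat z (\<lambda>m. inv (T (- int m - 1)))"
  define u where "u n = (if n \<ge> 0 then f (nat n) else g (nat (- n)))" for n
  have "u 0 = z" by (simp add: u_def f_def)
  moreover have "u (n + 1) = T n (u n)" for n
  proof (cases "n \<ge> 0")
    case True
    then have "nat (n + 1) = Suc (nat n)" by simp
    with True show ?thesis by (simp add: u_def f_def)
  next
    case False
    define m where "m = nat (- n - 1)"
    have n: "n = - int m - 1" and m: "nat (- n) = Suc m" using False by (auto simp: m_def)
    have "T n (g (Suc m)) = g m"
      unfolding g_def n using assms surj_f_inv_f by fastforce
    moreover have "u (n + 1) = g m"
      by (cases "m = 0") (auto simp: u_def n f_def g_def)
    ultimately show ?thesis using False m by (simp add: u_def)
  qed
  ultimately show thesis by (rule that)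
qed

text \<open>Glues one wave per cell along an orbit of the one-cell transfer maps. Allowing any
  \<open>P\<close> inside the lattice lets one construction serve both the periodic and the
  truncated operator: at lattice points outside \<open>P\<close> the kick \<open>\<kappa> n\<close>
  vanishes.\<close>

lemma delta_solution_exists:
  assumes "L > 0" "P \<subseteq> lattice L" "\<omega> \<noteq> 0"
  obtains \<psi> \<psi>' where "delta_solution_with A P (\<omega>\<^sup>2) \<psi> \<psi>'" "\<psi> 0 = x0" "(\<psi>' \<longlongrightarrow> \<omega> * y0) (at_left 0)"
proof -
  define pt where "pt n = of_int n * L" for n :: int
  define \<kappa> where "\<kappa> n = complex_of_real (if pt n \<in> P then A else 0) / \<omega>" for n
  define T where "T n = (\<lambda>(x, y). (wave \<omega> (pt n) x (y + \<kappa> n * x) (pt (n + 1)),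
     wave \<omega> (pt n) (y + \<kappa> n * x) (- x) (pt (n + 1))))" for n
  \<comment> \<open>A transfer map is a kick followed by a rotation, so rotating back and
    subtracting the kick inverts it.\<close>
  have "surj (T n)" for n
  proof (rule surjI)
    fix z :: "complex \<times> complex"
    obtain X Y where z: "z = (X, Y)" by force
    define c where "c = cos (\<omega> * of_real (pt (n + 1) - pt n))"
    define s where "s = sin (\<omega> * of_real (pt (n + 1) - pt n))"
    have cs: "c * c + s * s = 1" unfolding c_def s_def by (rule sin_cos_squared_add3)
    have "(c * X - s * Y) * c + (s * X + c * Y) * s = (c * c + s * s) * X"
      "(s * X + c * Y) * c - (c * X - s * Y) * s = (c * c + s * s) * Y"
      by algebra+
    then have "(c * X - s * Y) * c + (s * X + c * Y) * s = X"
      "(s * X + c * Y) * c - (c * X - s * Y) * s = Y" by (simp_all add: cs)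
    then show "T n ((\<lambda>(X, Y). (c * X - s * Y, s * X + c * Y - \<kappa> n * (c * X - s * Y))) z) = z"
      by (simp add: z T_def wave_def c_def[symmetric] s_def[symmetric] del: of_real_diff)
  qed
  then obtain u where u: "u 0 = (x0, y0)" "\<And>n. u (n + 1) = T n (u n)"
    using bi_infinite_orbit by metis
  define a where "a n = fst (u n)" for n
  define b where "b n = snd (u n)" for n
  define b' where "b' n = b n + \<kappa> n * a n" for n
  have aS: "a (n + 1) = wave \<omega> (pt n) (a n) (b' n) (pt (n + 1))"
    and bS: "b (n + 1) = wave \<omega> (pt n) (b' n) (- a n) (pt (n + 1))" for n
    by (simp_all add: a_def b_def b'_def u(2) T_def split: prod.split)
  define h where "h n = wave \<omega> (pt n) (a n) (b' n)" for n
  define h' where "h' n x = \<omega> * wave \<omega> (pt n) (b' n) (- a n) x" for n x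
  \<comment> \<open>The wave of the preceding cell, rebased at \<open>pt n\<close>, has the
    coefficients \<open>a n\<close> and \<open>b n\<close>. The outgoing wave has
    \<open>b' n\<close> instead, so the two differ exactly by the kick.\<close>
  have hprev: "h (n - 1) = wave \<omega> (pt n) (a n) (b n)" for n
    using aS[of "n - 1"] bS[of "n - 1"] by (auto simp: h_def wave_shift)
  have hprev': "h' (n - 1) = (\<lambda>x. \<omega> * wave \<omega> (pt n) (b n) (- a n) x)" for n
  proof
    fix x
    have "wave \<omega> (pt (n - 1)) (- a (n - 1)) (- b' (n - 1)) (pt n) = - a n"
      using aS[of "n - 1"] by (simp add: wave_def)
    then show "h' (n - 1) x = \<omega> * wave \<omega> (pt n) (b n) (- a n) x"
      using wave_shift[of \<omega> "pt n" "pt (n - 1)" "b' (n - 1)" "- a (n - 1)" x]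
        bS[of "n - 1"] by (simp add: h'_def)
  qed
  define \<psi> where "\<psi> x = h \<lfloor>x / L\<rfloor> x" for x
  define \<psi>' where "\<psi>' x = h' \<lfloor>x / L\<rfloor> x" for x
  have fl: "\<lfloor>x / L\<rfloor> = n" if "pt n \<le> x" "x < pt (n + 1)" for x n
    using that \<open>L > 0\<close> by (intro floor_unique) (auto simp: pt_def field_simps)
  have pt_mono: "pt n < pt (n + 1)" for n using \<open>L > 0\<close> by (simp add: pt_def algebra_simps)
  have pt_mono': "pt (n - 1) < pt n" for n using \<open>L > 0\<close> by (simp add: pt_def algebra_simps)
  have evr: "\<forall>\<^sub>F x in at_right (pt n). \<psi> x = h n x \<and> \<psi>' x = h' n x" for n
    using eventually_at_right_real[OF pt_mono[of n]]
    by eventually_elim (auto simp: \<psi>_def \<psi>'_def fl[of n])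
  have evl: "\<forall>\<^sub>F x in at_left (pt n). \<psi> x = h (n - 1) x \<and> \<psi>' x = h' (n - 1) x" for n
    using eventually_at_left_real[OF pt_mono'[of n]]
    by eventually_elim (use fl[of "n - 1"] in \<open>auto simp: \<psi>_def \<psi>'_def\<close>)
  have \<psi>pt: "\<psi> (pt n) = a n" for n
    using fl[of n "pt n"] pt_mono[of n] by (simp add: \<psi>_def h_def)
  have lim_left: "(\<psi> \<longlongrightarrow> a n) (at_left (pt n))" "(\<psi>' \<longlongrightarrow> \<omega> * b n) (at_left (pt n))" for n
  proof -
    have "(h (n - 1) \<longlongrightarrow> a n) (at_left (pt n))"
      unfolding hprev using tendsto_wave_at[of \<omega> "pt n" "a n" "b n" "pt n"] by simp
    then show "(\<psi> \<longlongrightarrow> a n) (at_left (pt n))"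
      by (rule Lim_transform_eventually) (use evl[of n] in \<open>auto elim: eventually_mono\<close>)
    have "(h' (n - 1) \<longlongrightarrow> \<omega> * b n) (at_left (pt n))"
      unfolding hprev' using tendsto_wave_at[of \<omega> "pt n" "b n" "- a n" "pt n"]
      by (intro tendsto_mult) auto
    then show "(\<psi>' \<longlongrightarrow> \<omega> * b n) (at_left (pt n))"
      by (rule Lim_transform_eventually) (use evl[of n] in \<open>auto elim: eventually_mono\<close>)
  qed
  have lim_right: "(\<psi> \<longlongrightarrow> a n) (at_right (pt n))" "(\<psi>' \<longlongrightarrow> \<omega> * b' n) (at_right (pt n))" for n
  proof -
    have "(h n \<longlongrightarrow> a n) (at_right (pt n))"
      unfolding h_def using tendsto_wave_at[of \<omega> "pt n" "a n" "b' n" "pt n"] by simp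
    then show "(\<psi> \<longlongrightarrow> a n) (at_right (pt n))"
      by (rule Lim_transform_eventually) (use evr[of n] in \<open>auto elim: eventually_mono\<close>)
    have "(h' n \<longlongrightarrow> \<omega> * b' n) (at_right (pt n))"
      unfolding h'_def using tendsto_wave_at[of \<omega> "pt n" "b' n" "- a n" "pt n"]
      by (intro tendsto_mult) auto
    then show "(\<psi>' \<longlongrightarrow> \<omega> * b' n) (at_right (pt n))"
      by (rule Lim_transform_eventually) (use evr[of n] in \<open>auto elim: eventually_mono\<close>)
  qed
  have dloc: "(\<psi> has_vector_derivative \<psi>' x) (at x) \<and> (\<psi>' has_vector_derivative - (\<omega>\<^sup>2 * \<psi> x)) (at x)"
    if S: "open S" "x \<in> S" and eq: "\<And>y. y \<in> S \<Longrightarrow> \<psi> y = h n y \<and> \<psi>' y = h' n y" for x n S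
  proof
    have "(h n has_vector_derivative \<psi>' x) (at x)"
      using eq[OF S(2)] has_vector_derivative_wave[of \<omega> "pt n" "a n" "b' n" x] by (simp add: h_def h'_def)
    then show "(\<psi> has_vector_derivative \<psi>' x) (at x)"
      by (rule has_vector_derivative_transform_within_open[OF _ S]) (use eq in auto)
    have "(h' n has_vector_derivative \<omega> * (\<omega> * wave \<omega> (pt n) (- a n) (- b' n) x)) (at x)"
      unfolding h'_def by (intro has_vector_derivative_mult_right has_vector_derivative_wave)
    moreover have "\<omega> * (\<omega> * wave \<omega> (pt n) (- a n) (- b' n) x) = - (\<omega>\<^sup>2 * \<psi> x)"
      using eq[OF S(2)] by (simp add: h_def wave_def power2_eq_square algebra_simps)
    ultimately have "(h' n has_vector_derivative - (\<omega>\<^sup>2 * \<psi> x)) (at x)" by simp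
    then show "(\<psi>' has_vector_derivative - (\<omega>\<^sup>2 * \<psi> x)) (at x)"
      by (rule has_vector_derivative_transform_within_open[OF _ S]) (use eq in auto)
  qed
  have loc: "(\<exists>n. x = pt n) \<or> (\<exists>n. pt n < x \<and> x < pt (n + 1))" for x
  proof -
    have "pt \<lfloor>x / L\<rfloor> \<le> x" "x < pt (\<lfloor>x / L\<rfloor> + 1)"
      using \<open>L > 0\<close> by (simp_all add: pt_def flip: pos_le_divide_eq pos_divide_less_eq)
    then show ?thesis by (metis order_le_less)
  qed
  have der: "(\<psi> has_vector_derivative \<psi>' x) (at x) \<and> (\<psi>' has_vector_derivative - (\<omega>\<^sup>2 * \<psi> x)) (at x)"
    if "x \<notin> P" for x
    using loc[of x]
  proof (elim disjE exE conjE)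
    \<comment> \<open>A lattice point without interaction: the waves on both sides coincide, so the
      derivative is taken on the union of the two cells.\<close>
    fix n assume x: "x = pt n"
    then have "\<kappa> n = 0" using that by (simp add: \<kappa>_def)
    then have b': "b' n = b n" by (simp add: b'_def)
    show ?thesis
    proof (rule dloc[of "{pt (n - 1)<..<pt (n + 1)}"])
      fix y assume y: "y \<in> {pt (n - 1)<..<pt (n + 1)}"
      show "\<psi> y = h n y \<and> \<psi>' y = h' n y"
      proof (cases "y < pt n")
        case True
        then have "\<lfloor>y / L\<rfloor> = n - 1" using y by (intro fl) auto
        moreover have "h (n - 1) = h n" unfolding hprev unfolding h_def b' ..
        moreover have "h' (n - 1) = h' n" unfolding hprev' unfolding h'_def b' ..
        ultimately show ?thesis by (simp add: \<psi>_def \<psi>'_def)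
      next
        case False
        then have "\<lfloor>y / L\<rfloor> = n" using y by (intro fl) auto
        then show ?thesis by (simp add: \<psi>_def \<psi>'_def)
      qed
    qed (use x pt_mono pt_mono' in auto)
  next
    fix n assume x: "pt n < x" "x < pt (n + 1)"
    show ?thesis
      by (rule dloc[of "{pt n<..<pt (n + 1)}"]) (use x fl[of n] in \<open>auto simp: \<psi>_def \<psi>'_def\<close>)
  qed
  have "isCont \<psi> x" for x
  proof (cases "x \<in> P")
    case True
    then obtain n where "x = pt n" using \<open>P \<subseteq> lattice L\<close> unfolding lattice_def pt_def by auto
    then show ?thesis
      using lim_left(1)[of n] lim_right(1)[of n]
      by (simp add: isCont_def filterlim_at_split \<psi>pt)
  next
    case False
    then show ?thesis using der has_vector_derivative_continuous by blast
  qed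
  moreover have "\<exists>l r. (\<psi>' \<longlongrightarrow> l) (at_left p) \<and> (\<psi>' \<longlongrightarrow> r) (at_right p) \<and>
          r - l = complex_of_real A * \<psi> p" if pP: "p \<in> P" for p
  proof -
    obtain n where p: "p = pt n" using \<open>P \<subseteq> lattice L\<close> pP unfolding lattice_def pt_def by auto
    have "\<omega> * b' n - \<omega> * b n = complex_of_real A * \<psi> p"
      using pP \<open>\<omega> \<noteq> 0\<close> by (simp add: b'_def \<kappa>_def p \<psi>pt algebra_simps)
    then show ?thesis using lim_left(2)[of n] lim_right(2)[of n] p by blast
  qed
  ultimately have "delta_solution_with A P (\<omega>\<^sup>2) \<psi> \<psi>'"
    unfolding delta_solution_with_def using der by (auto simp: continuous_on_eq_continuous_at)
  moreover have "pt 0 = 0" by (simp add: pt_def)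
  ultimately show ?thesis
    using that[of \<psi> \<psi>'] \<psi>pt[of 0] lim_left(2)[of 0] u(1) by (simp add: a_def b_def)
qed

section \<open>Pruefer data, the monodromy matrix and its trace\<close>

lemma pruefer_data_eq:
  assumes sol: "delta_solution_with A P E \<psi> \<psi>'" and "a < x" "{a<..<x} \<inter> P = {}"
    and "(\<psi>' \<longlongrightarrow> v) (at_left x)"
  shows "pruefer_data \<omega> \<psi> x = vector [\<psi> x, v / \<omega>]"
proof -
  have "isCont \<psi> x" using sol unfolding delta_solution_with_def
    by (simp add: continuous_on_eq_continuous_at)
  then have "(\<psi> \<longlongrightarrow> \<psi> x) (at_left x)" by (simp add: filterlim_at_split isCont_def)
  then have 1: "Lim (at_left x) \<psi> = \<psi> x" by (intro tendsto_Lim) auto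
  have "\<forall>\<^sub>F y in at_left x. \<psi>' y = vector_derivative \<psi> (at y)"
    using eventually_at_left_real[OF \<open>a < x\<close>]
  proof eventually_elim
    case (elim y)
    then have "y \<notin> P" using assms(3) by auto
    then show ?case
      using sol vector_derivative_at unfolding delta_solution_with_def by metis
  qed
  with assms(4) have "((\<lambda>y. vector_derivative \<psi> (at y)) \<longlongrightarrow> v) (at_left x)"
    by (rule Lim_transform_eventually)
  then have 2: "Lim (at_left x) (\<lambda>y. vector_derivative \<psi> (at y)) = v" by (intro tendsto_Lim) auto
  show ?thesis unfolding pruefer_data_def 1 2 ..
qed

lemma lattice_gap:
  assumes "L > 0"
  shows "{of_int n * L<..<of_int (n + 1) * L} \<inter> lattice L = {}"
proof -
  have False if "of_int n * L < of_int m * L" "of_int m * L < of_int (n + 1) * L" for m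
  proof -
    have "n < m" "m < n + 1" using that \<open>L > 0\<close> mult_less_cancel_right_pos by auto
    then show False by simp
  qed
  then show ?thesis unfolding lattice_def greaterThanLessThan_iff by fastforce
qed

text \<open>The matrix is the rotation by \<open>\<omega> * L\<close> times the jump matrix with
  rows (1, 0) and (A / \<omega>, 1): data are taken on the left of the interaction, so the jump acts
  first.\<close>

lemma monodromy_eq:
  assumes "L > 0" "\<omega> \<noteq> 0"
  shows "monodromy A L \<omega> = vector [
     vector [cos (\<omega> * L) + of_real A / \<omega> * sin (\<omega> * L), sin (\<omega> * L)],
     vector [- sin (\<omega> * L) + of_real A / \<omega> * cos (\<omega> * L), cos (\<omega> * L)]]" (is "_ = ?M")
  unfolding monodromy_def
proof (rule the_equality)
  have gap: "{- L<..<0} \<inter> lattice L = {}" "{0<..<L} \<inter> lattice L = {}"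
    using lattice_gap[OF \<open>L > 0\<close>, of "- 1"] lattice_gap[OF \<open>L > 0\<close>, of 0] by simp_all
  have 0: "0 \<in> lattice L" unfolding lattice_def by (rule image_eqI[of _ _ 0]) auto
  have main: "pruefer_data \<omega> \<psi> L = ?M *v pruefer_data \<omega> \<psi> 0"
    if sol: "delta_solution_with A (lattice L) (\<omega>\<^sup>2) \<psi> \<psi>'" for \<psi> \<psi>'
  proof -
    obtain v where v: "(\<psi>' \<longlongrightarrow> v) (at_left 0)"
      using sol 0 unfolding delta_solution_with_def by blast
    note step = solution_transfer[OF sol \<open>\<omega> \<noteq> 0\<close> \<open>L > 0\<close> gap(2) v]
    have "pruefer_data \<omega> \<psi> 0 = vector [\<psi> 0, v / \<omega>]"
      using pruefer_data_eq[OF sol _ gap(1) v] \<open>L > 0\<close> by simp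
    moreover have "pruefer_data \<omega> \<psi> L = vector [\<psi> L,
      (\<omega> * wave \<omega> 0 ((v + of_real (if 0 \<in> lattice L then A else 0) * \<psi> 0) / \<omega>) (- \<psi> 0) L) / \<omega>]"
      by (rule pruefer_data_eq[OF sol \<open>L > 0\<close> gap(2) step(2)])
    ultimately show ?thesis
      using \<open>\<omega> \<noteq> 0\<close> 0 unfolding step(1)
      by (simp add: vec_eq_iff forall_2 matrix_vector_mult_def sum_2 wave_def
          add_divide_distrib diff_divide_distrib algebra_simps)
  qed
  then show "\<forall>\<psi>. delta_solution A (lattice L) (\<omega>\<^sup>2) \<psi> \<longrightarrow>
        pruefer_data \<omega> \<psi> L = ?M *v pruefer_data \<omega> \<psi> 0"
    unfolding delta_solution_iff by blast
  fix M
  assume M: "\<forall>\<psi>. delta_solution A (lattice L) (\<omega>\<^sup>2) \<psi> \<longrightarrow>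
        pruefer_data \<omega> \<psi> L = M *v pruefer_data \<omega> \<psi> 0"
  \<comment> \<open>Uniqueness: every vector \<open>z\<close> occurs as the data of some solution at
    0, so two matrices with the defining property agree everywhere.\<close>
  have "M *v z = ?M *v z" for z :: "complex ^ 2"
  proof -
    obtain \<psi> \<psi>' where sol: "delta_solution_with A (lattice L) (\<omega>\<^sup>2) \<psi> \<psi>'"
      and z: "\<psi> 0 = z $ 1" "(\<psi>' \<longlongrightarrow> \<omega> * z $ 2) (at_left 0)"
      by (rule delta_solution_exists[OF \<open>L > 0\<close> order_refl \<open>\<omega> \<noteq> 0\<close>])
    have "pruefer_data \<omega> \<psi> 0 = vector [z $ 1, z $ 2]"
      using pruefer_data_eq[OF sol _ gap(1) z(2), of \<omega>] \<open>L > 0\<close> \<open>\<omega> \<noteq> 0\<close> z(1) by simp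
    also have "\<dots> = z" by (simp add: vec_eq_iff forall_2)
    finally show ?thesis using main[OF sol] M sol unfolding delta_solution_iff by metis
  qed
  then show "M = ?M" by (simp add: matrix_eq)
qed

lemma half_trace_eq:
  assumes "L > 0" "\<omega> \<noteq> 0"
  shows "half_trace A L \<omega> = cos (\<omega> * L) + of_real A / (2 * \<omega>) * sin (\<omega> * L)"
  using assms by (simp add: half_trace_def monodromy_eq trace_def sum_2 field_simps)

text \<open>For A > 0 this value exceeds 1, which keeps \<omega> = 0 out of the bands.\<close>

lemma half_trace_0:
  assumes "L > 0"
  shows "half_trace A L 0 = 1 + of_real (A * L / 2)"
proof -
  have "filterlim (\<lambda>z::complex. z * L) (at 0) (at 0)"
  proof -
    have "((\<lambda>z::complex. z * L) \<longlongrightarrow> 0 * complex_of_real L) (at 0)"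
      by (intro tendsto_mult tendsto_ident_at tendsto_const)
    then show ?thesis using \<open>L > 0\<close>
      by (auto simp: filterlim_at eventually_at_filter)
  qed
  moreover have "((\<lambda>z::complex. sin z / z) \<longlongrightarrow> 1) (at 0)"
    using DERIV_sin[of "0::complex"] by (simp add: has_field_derivative_iff)
  ultimately have "((\<lambda>z::complex. sin (z * L) / (z * L)) \<longlongrightarrow> 1) (at 0)"
    by (rule filterlim_compose[rotated])
  then have "((\<lambda>z. cos (z * L) + of_real (A * L / 2) * (sin (z * L) / (z * L))) \<longlongrightarrow>
      cos (0 * complex_of_real L) + of_real (A * L / 2) * 1) (at (0::complex))"
    by (intro tendsto_add tendsto_mult tendsto_const tendsto_cos tendsto_ident_at)
  then have "((\<lambda>z. cos (z * L) + of_real (A * L / 2) * (sin (z * L) / (z * L))) \<longlongrightarrow>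
      1 + of_real (A * L / 2)) (at (0::complex))" by simp
  then have "((\<lambda>z. trace (monodromy A L z) / 2) \<longlongrightarrow> 1 + of_real (A * L / 2)) (at (0::complex))"
    by (rule Lim_transform_eventually)
       (use assms in \<open>auto simp: eventually_at_filter monodromy_eq trace_def sum_2 field_simps\<close>)
  then show ?thesis unfolding half_trace_def by (auto intro: tendsto_Lim)
qed

section \<open>The transmission coefficient\<close>

text \<open>With the index shifted by one, these are the Chebyshev polynomials of the second kind.\<close>

fun cheb_U :: "nat \<Rightarrow> 'a::comm_ring_1 \<Rightarrow> 'a" where
  "cheb_U 0 y = 0"
| "cheb_U (Suc 0) y = 1"
| "cheb_U (Suc (Suc n)) y = 2 * y * cheb_U (Suc n) y - cheb_U n y"

lemma of_real_cheb_U: "of_real (cheb_U n y) = cheb_U n (of_real y)"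
  by (induction n y rule: cheb_U.induct) simp_all

lemma cheb_U_cos:
  fixes z :: "'a::{real_normed_field,banach}"
  shows "cheb_U n (cos z) * sin z = sin (of_nat n * z)"
proof (induction n "cos z" rule: cheb_U.induct)
  case (3 n)
  have "sin (of_nat (Suc (Suc n)) * z) + sin (of_nat n * z) = 2 * cos z * sin (of_nat (Suc n) * z)"
    using sin_add[of "of_nat (Suc n) * z" z] sin_diff[of "of_nat (Suc n) * z" z]
    by (simp add: algebra_simps)
  with 3 show ?case by (simp add: algebra_simps)
qed auto

text \<open>The quadratic form is invariant under the recurrence. It is what makes the determinant
  of the N-th power of the monodromy matrix equal to 1.\<close>

lemma cheb_U_det: "(cheb_U (Suc n) y)\<^sup>2 - 2 * y * cheb_U (Suc n) y * cheb_U n y + (cheb_U n y)\<^sup>2 = 1"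
  by (induction n) (simp_all add: power2_eq_square algebra_simps)

lemma cheb_U_minus: "cheb_U n (- y) = - ((- 1) ^ n) * cheb_U n y"
  by (induction n y rule: cheb_U.induct) (simp_all add: algebra_simps)

lemma cheb_U_1: "cheb_U n (1 :: 'a::comm_ring_1) = of_nat n"
proof -
  have "cheb_U n (1 :: 'a) = of_nat n \<and> cheb_U (Suc n) (1 :: 'a) = of_nat (Suc n)"
    by (induction n) simp_all
  then show ?thesis ..
qed

lemma continuous_on_cheb_U [continuous_intros]:
  fixes f :: "'b::topological_space \<Rightarrow> 'a::real_normed_field"
  assumes "continuous_on S f"
  shows "continuous_on S (\<lambda>x. cheb_U n (f x))"
  using assms
  \<comment> \<open>The rule carries the argument of the polynomial along, while the goal has no
    single such value; hence a dummy instance.\<close>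
  by (induction n "undefined :: 'a" rule: cheb_U.induct) (auto intro!: continuous_intros)

text \<open>Zeros of the sine are simple and therefore isolated, and the polynomial expression is
  continuous, so it supplies the value at the removable singularities. From here on the ratio
  depends on \<open>k\<close> only through cos k.\<close>

lemma sin_ratio_eq: "sin_ratio N z = cheb_U N (cos z)"
proof (cases "sin z = 0")
  case True
  have "\<forall>\<^sub>F w in at z. sin w \<noteq> 0"
  proof -
    have "((\<lambda>w. (sin w - sin z) / (w - z)) \<longlongrightarrow> cos z) (at z)"
      using DERIV_sin[of z] by (simp add: has_field_derivative_iff)
    moreover have "cos z \<noteq> 0" using True sin_cos_squared_add[of z] by auto
    ultimately have "\<forall>\<^sub>F w in at z. (sin w - sin z) / (w - z) \<noteq> 0"
      by (rule tendsto_imp_eventually_ne)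
    then show ?thesis by eventually_elim (use True in auto)
  qed
  have "continuous_on UNIV (\<lambda>w::complex. cheb_U N (cos w))"
    by (intro continuous_intros)
  then have "((\<lambda>w. cheb_U N (cos w)) \<longlongrightarrow> cheb_U N (cos z)) (at z)"
    by (auto simp: continuous_on_def)
  then have "((\<lambda>w. sin (of_nat N * w) / sin w) \<longlongrightarrow> cheb_U N (cos z)) (at z)"
    by (rule Lim_transform_eventually)
       (use \<open>\<forall>\<^sub>F w in at z. sin w \<noteq> 0\<close> in \<open>auto elim!: eventually_mono simp flip: cheb_U_cos\<close>)
  then show ?thesis using True by (auto simp: sin_ratio_def intro: tendsto_Lim)
next
  case False
  then show ?thesis by (simp add: sin_ratio_def flip: cheb_U_cos)
qed

text \<open>The power formula for a matrix of determinant 1, phrased for orbits. The recursion is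
  assumed only for \<open>j < N\<close>, because behind the last interaction the orbit no longer
  follows the same matrix.\<close>

lemma cheb_U_iterate:
  fixes x y :: "nat \<Rightarrow> 'a::comm_ring_1"
  assumes step: "\<And>j. j < N \<Longrightarrow> x (Suc j) = m11 * x j + m12 * y j"
      "\<And>j. j < N \<Longrightarrow> y (Suc j) = m21 * x j + m22 * y j"
    and det: "m11 * m22 - m12 * m21 = 1" and tr: "m11 + m22 = 2 * F" and "j < N"
  shows "x (Suc j) = (cheb_U (Suc j) F * m11 - cheb_U j F) * x 0 + cheb_U (Suc j) F * m12 * y 0"
    and "y (Suc j) = cheb_U (Suc j) F * m21 * x 0 + (cheb_U (Suc j) F * m22 - cheb_U j F) * y 0"
proof -
  have "x (Suc j) = (cheb_U (Suc j) F * m11 - cheb_U j F) * x 0 + cheb_U (Suc j) F * m12 * y 0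
     \<and> y (Suc j) = cheb_U (Suc j) F * m21 * x 0 + (cheb_U (Suc j) F * m22 - cheb_U j F) * y 0"
    using \<open>j < N\<close>
  proof (induction j)
    case 0
    then show ?case using step[of 0] by simp
  next
    case (Suc j)
    \<comment> \<open>The determinant condition as a rewrite rule for products nested to the right,
      which is how they appear after expansion.\<close>
    have m: "m12 * (m21 * w) = m11 * (m22 * w) - w" for w
      using arg_cong[OF det, of "\<lambda>t. t * w"] by (simp add: algebra_simps)
    have eq: "cheb_U (Suc (Suc j)) F = (m11 + m22) * cheb_U (Suc j) F - cheb_U j F"
      using tr by simp
    have IH: "x (Suc j) = (cheb_U (Suc j) F * m11 - cheb_U j F) * x 0 + cheb_U (Suc j) F * m12 * y 0"
      "y (Suc j) = cheb_U (Suc j) F * m21 * x 0 + (cheb_U (Suc j) F * m22 - cheb_U j F) * y 0"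
      using Suc.IH Suc.prems by simp_all
    show ?case
      unfolding step[OF Suc.prems] eq IH
      using m[of "cheb_U (Suc j) F * x 0"] m[of "cheb_U (Suc j) F * y 0"]
      by (simp add: algebra_simps)
  qed
  then show "x (Suc j) = (cheb_U (Suc j) F * m11 - cheb_U j F) * x 0 + cheb_U (Suc j) F * m12 * y 0"
    and "y (Suc j) = cheb_U (Suc j) F * m21 * x 0 + (cheb_U (Suc j) F * m22 - cheb_U j F) * y 0"
    by auto
qed

section \<open>Scattering solutions of the truncated operator\<close>

lemma wave_exp:
  "c * exp (\<i> * \<omega> * of_real x) + d * exp (- \<i> * \<omega> * of_real x) = wave \<omega> 0 (c + d) (\<i> * (c - d)) x"
proof -
  have "exp (\<i> * (\<omega> * of_real x)) = cos (\<omega> * of_real x) + \<i> * sin (\<omega> * of_real x)"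
    by (rule exp_Euler)
  moreover have "exp (- (\<i> * (\<omega> * of_real x))) = cos (\<omega> * of_real x) - \<i> * sin (\<omega> * of_real x)"
    using exp_Euler[of "- (\<omega> * of_real x)"] by simp
  ultimately show ?thesis by (simp add: wave_def ring_distribs mult.assoc)
qed

text \<open>An outgoing plane wave with value \<sigma> at \<open>p\<close> has Pruefer data
  (\<sigma>, \<i> \<sigma>) there; this is the matching condition on the right.\<close>

lemma wave_exp_shift:
  "c * exp (\<i> * \<omega> * of_real x) =
     wave \<omega> p (c * exp (\<i> * \<omega> * of_real p)) (\<i> * (c * exp (\<i> * \<omega> * of_real p))) x"
proof -
  have "c * exp (\<i> * \<omega> * of_real x) = c * exp (\<i> * \<omega> * of_real p) * exp (\<i> * (\<omega> * of_real (x - p)))"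
    by (simp add: algebra_simps flip: exp_add)
  then show ?thesis by (simp only: exp_Euler wave_def) (simp add: algebra_simps)
qed

lemma solution_deriv_wave:
  assumes sol: "delta_solution_with A P E \<psi> \<psi>'" and S: "open S" "S \<inter> P = {}"
    and eq: "\<And>x. x \<in> S \<Longrightarrow> \<psi> x = wave \<omega> p \<alpha> \<beta> x" and "x \<in> S"
  shows "\<psi>' x = \<omega> * wave \<omega> p \<beta> (- \<alpha>) x"
proof -
  have "(\<psi> has_vector_derivative \<psi>' x) (at x)"
    using assms unfolding delta_solution_with_def by blast
  moreover have "(\<psi> has_vector_derivative \<omega> * wave \<omega> p \<beta> (- \<alpha>) x) (at x)"
    by (rule has_vector_derivative_transform_within_open[OF has_vector_derivative_wave S(1) \<open>x \<in> S\<close>])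
       (simp add: eq)
  ultimately show ?thesis by (rule vector_derivative_unique_at)
qed

lemma truncated_lattice_subset: "truncated_lattice L N \<subseteq> lattice L"
proof -
  have "real i * L = of_int (int i) * L" for i by simp
  then show ?thesis unfolding truncated_lattice_def lattice_def by blast
qed

text \<open>The last interaction sits at (N - 1) L, so N full periods lead to the left limits at N
  L, and these pass unchanged to the right of N L.\<close>

lemma truncated_solution_right:
  assumes sol: "delta_solution_with A (truncated_lattice L N) (\<omega>\<^sup>2) \<psi> \<psi>'"
    and "\<omega> \<noteq> 0" "L > 0" and N: "N = Suc j"
    and lim: "(\<psi>' \<longlongrightarrow> \<omega> * y0) (at_left 0)" and "x > real N * L"
  defines "c \<equiv> cos (\<omega> * L)" and "s \<equiv> sin (\<omega> * L)"
  defines "F \<equiv> c + of_real A / (2 * \<omega>) * s"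
  defines "X \<equiv> (cheb_U N F * (c + of_real A / \<omega> * s) - cheb_U j F) * \<psi> 0 + cheb_U N F * s * y0"
    and "Y \<equiv> cheb_U N F * (- s + of_real A / \<omega> * c) * \<psi> 0 + (cheb_U N F * c - cheb_U j F) * y0"
  shows "\<psi> x = wave \<omega> (real N * L) X Y x \<and> \<psi>' x = \<omega> * wave \<omega> (real N * L) Y (- X) x"
proof -
  let ?P = "truncated_lattice L N"
  have gap: "{real i * L<..<real (Suc i) * L} \<inter> ?P = {}" for i
    using lattice_gap[OF \<open>L > 0\<close>, of "int i"] truncated_lattice_subset[of L N]
    by (force simp: add.commute)
  have mem: "real i * L \<in> ?P" if "i < N" for i using that by (auto simp: truncated_lattice_def)
  have nmem: "{real N * L..} \<inter> ?P = {}" using \<open>L > 0\<close> by (auto simp: truncated_lattice_def)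
  \<comment> \<open>The left limits of \<open>\<psi>' / \<omega>\<close> as a sequence.
    \<open>Lim\<close> means something only once existence of the limits is known, which the
    induction for \<open>ylim\<close> provides; the start is prescribed.\<close>
  define y where "y i = (if i = 0 then y0 else Lim (at_left (real i * L)) \<psi>' / \<omega>)" for i
  have cs: "\<omega> * of_real (real (Suc i) * L - real i * L) = \<omega> * L" for i by (simp add: algebra_simps)
  have step: "\<psi> (real (Suc i) * L) = wave \<omega> (real i * L) (\<psi> (real i * L)) (y i + of_real A / \<omega> * \<psi> (real i * L)) (real (Suc i) * L)"
    "(\<psi>' \<longlongrightarrow> \<omega> * wave \<omega> (real i * L) (y i + of_real A / \<omega> * \<psi> (real i * L)) (- \<psi> (real i * L)) (real (Suc i) * L)) (at_left (real (Suc i) * L))"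
    if "(\<psi>' \<longlongrightarrow> \<omega> * y i) (at_left (real i * L))" "i < N" for i
    using solution_transfer[OF sol \<open>\<omega> \<noteq> 0\<close> _ gap that(1)] mem[OF that(2)] \<open>L > 0\<close> \<open>\<omega> \<noteq> 0\<close>
    by (simp_all add: add_divide_distrib)
  have ylim: "(\<psi>' \<longlongrightarrow> \<omega> * y i) (at_left (real i * L))" if "i \<le> N" for i
    using that
  proof (induction i)
    case 0
    then show ?case using lim by (simp add: y_def)
  next
    case (Suc i)
    then obtain l where l: "(\<psi>' \<longlongrightarrow> l) (at_left (real (Suc i) * L))"
      using step(2)[of i] by auto
    then have "Lim (at_left (real (Suc i) * L)) \<psi>' = l"
      by (intro tendsto_Lim) auto
    with l show ?case using \<open>\<omega> \<noteq> 0\<close> by (simp add: y_def del: of_nat_Suc)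
  qed
  have s1: "\<psi> (real (Suc i) * L) = (c + of_real A / \<omega> * s) * \<psi> (real i * L) + s * y i" if "i < N" for i
    using step(1)[OF ylim that] that
    by (simp only: wave_def cs c_def s_def) (simp add: algebra_simps)
  have s2: "y (Suc i) = (- s + of_real A / \<omega> * c) * \<psi> (real i * L) + c * y i" if "i < N" for i
  proof -
    have "\<omega> * y (Suc i) = \<omega> * wave \<omega> (real i * L) (y i + of_real A / \<omega> * \<psi> (real i * L)) (- \<psi> (real i * L)) (real (Suc i) * L)"
      using ylim[of "Suc i"] step(2)[OF ylim that] that by (intro tendsto_unique[of "at_left (real (Suc i) * L)"]) auto
    then show ?thesis using \<open>\<omega> \<noteq> 0\<close>
      by (simp only: wave_def cs c_def s_def mult_cancel_left) (simp add: algebra_simps)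
  qed
  have "(c + of_real A / \<omega> * s) * c - s * (- s + of_real A / \<omega> * c) = c\<^sup>2 + s\<^sup>2"
    by (simp add: algebra_simps power2_eq_square)
  then have det: "(c + of_real A / \<omega> * s) * c - s * (- s + of_real A / \<omega> * c) = 1"
    by (simp add: c_def s_def)
  have tr: "c + of_real A / \<omega> * s + c = 2 * F" using \<open>\<omega> \<noteq> 0\<close> by (simp add: F_def field_simps)
  note it = cheb_U_iterate[of N "\<lambda>i. \<psi> (real i * L)" _ _ y, OF s1 s2 det tr, of j, folded N]
  have XY: "\<psi> (real N * L) = X" "y N = Y"
    using it N by (simp_all add: X_def Y_def y_def)
  have "\<psi> x = wave \<omega> (real N * L) (\<psi> (real N * L)) ((\<omega> * y N + of_real (if real N * L \<in> ?P then A else 0) * \<psi> (real N * L)) / \<omega>) x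
    \<and> \<psi>' x = \<omega> * wave \<omega> (real N * L) ((\<omega> * y N + of_real (if real N * L \<in> ?P then A else 0) * \<psi> (real N * L)) / \<omega>) (- \<psi> (real N * L)) x"
  proof (rule solution_wave_right[OF sol \<open>\<omega> \<noteq> 0\<close> _ _ _ _ ylim, where S = "{real N * L<..}"])
    show "{real N * L<..} \<inter> {real N * L<..<q} \<noteq> {}" if "q > real N * L" for q
      using dense[OF that] by auto
    show "{real N * L<..} \<inter> ?P = {}" using nmem by (auto simp: disjoint_iff)
  qed (use \<open>x > real N * L\<close> in auto)
  moreover have "real N * L \<notin> ?P" using nmem by auto
  ultimately show ?thesis using XY \<open>\<omega> \<noteq> 0\<close> by simp
qed

text \<open>Matching plane waves means that the N-period matrix p sends (1 + r, \<i> (1 - r)) to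
  \<tau> (1, \<i>), where \<tau> is t times a phase. Eliminating r gives \<tau> d = 2, so everything
  reduces to the modulus of \<open>d\<close>.\<close>

lemma cmod_transmission:
  fixes A L \<omega> :: real
  assumes "L > 0" "\<omega> \<noteq> 0" "N \<ge> 1"
  defines "F \<equiv> cos (\<omega> * L) + A / (2 * \<omega>) * sin (\<omega> * L)"
  shows "cmod (transmission A L N \<omega>) = 1 / sqrt (1 + (A / (2 * \<omega>) * cheb_U N F)\<^sup>2)"
proof -
  obtain j where N: "N = Suc j" using \<open>N \<ge> 1\<close> by (cases N) auto
  let ?P = "truncated_lattice L N"
  define w where "w = complex_of_real \<omega>"
  have w0: "w \<noteq> 0" using \<open>\<omega> \<noteq> 0\<close> by (simp add: w_def)
  define c where "c = cos (\<omega> * L)"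
  define s where "s = sin (\<omega> * L)"
  define U where "U = cheb_U N F"
  define V where "V = cheb_U j F"
  define p11 where "p11 = U * (c + A / \<omega> * s) - V"
  define p12 where "p12 = U * s"
  define p21 where "p21 = U * (- s + A / \<omega> * c)"
  define p22 where "p22 = U * c - V"
  have cs: "c\<^sup>2 + s\<^sup>2 = 1" by (simp add: c_def s_def)
  have F: "2 * F = 2 * c + A / \<omega> * s" using \<open>\<omega> \<noteq> 0\<close> by (simp add: F_def c_def s_def field_simps)
  have "p11 * p22 - p12 * p21 = U\<^sup>2 * (c\<^sup>2 + s\<^sup>2) - U * V * (2 * c + A / \<omega> * s) + V\<^sup>2"
    unfolding p11_def p12_def p21_def p22_def by algebra
  also have "\<dots> = U\<^sup>2 - 2 * F * U * V + V\<^sup>2" unfolding cs F[symmetric] by simp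
  also have "\<dots> = 1" using cheb_U_det[of j F] by (simp add: U_def V_def N)
  finally have det: "p11 * p22 - p12 * p21 = 1" .
  define d where "d = Complex (p11 + p22) (p21 - p12)"
  have "(cmod d)\<^sup>2 = (p11 + p22)\<^sup>2 + (p21 - p12)\<^sup>2" by (simp add: d_def cmod_power2)
  \<comment> \<open>Splitting off the determinant leaves p11 - p22 and p12 + p21, which are A U /
    \<omega> times s and c. The multiples of V cancel, and c^2 + s^2 = 1 removes the angle.\<close>
  also have "\<dots> = 4 * (p11 * p22 - p12 * p21) + (p11 - p22)\<^sup>2 + (p12 + p21)\<^sup>2"
    by (simp add: power2_eq_square algebra_simps)
  also have "p11 - p22 = A / \<omega> * U * s" by (simp add: p11_def p22_def algebra_simps)
  also have "p12 + p21 = A / \<omega> * U * c" by (simp add: p12_def p21_def algebra_simps)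
  finally have "(cmod d)\<^sup>2 = 4 + (A / \<omega> * U)\<^sup>2 * (c\<^sup>2 + s\<^sup>2)"
    unfolding det by (simp only: power_mult_distrib distrib_left)
  then have d2: "(cmod d)\<^sup>2 = 4 * (1 + (A / (2 * \<omega>) * U)\<^sup>2)"
    unfolding cs by (simp add: power_divide power_mult_distrib)
  then have cd: "cmod d = 2 * sqrt (1 + (A / (2 * \<omega>) * U)\<^sup>2)"
    by (intro power2_eq_imp_eq[of "cmod d"]) (simp_all add: power_mult_distrib)
  have "1 + (A / (2 * \<omega>) * U)\<^sup>2 > 0" by (simp add: add_pos_nonneg)
  with d2 have d0: "d \<noteq> 0" by auto
  define \<tau> where "\<tau> = 2 / d"
  have \<tau>d: "\<tau> * d = 2" using d0 by (simp add: \<tau>_def)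
  have d_eq: "d = p11 + p22 + \<i> * (p21 - p12)" by (simp add: d_def Complex_eq)
  have detc: "complex_of_real p11 * p22 - of_real p12 * p21 = 1"
    using arg_cong[OF det, of complex_of_real] by simp
  have right: "\<psi> x = wave w (real N * L) (p11 * \<psi> 0 + p12 * y0) (p21 * \<psi> 0 + p22 * y0) x \<and>
      \<psi>' x = w * wave w (real N * L) (p21 * \<psi> 0 + p22 * y0) (- (p11 * \<psi> 0 + p12 * y0)) x"
    if "delta_solution_with A ?P (w\<^sup>2) \<psi> \<psi>'" "(\<psi>' \<longlongrightarrow> w * y0) (at_left 0)" "x > real N * L"
    for \<psi> \<psi>' :: "real \<Rightarrow> complex" and y0 :: complex and x
  proof -
    have "cos (w * L) = of_real c" "sin (w * L) = of_real s"
      by (simp_all add: w_def c_def s_def cos_of_real sin_of_real flip: of_real_mult)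
    moreover have "of_real c + of_real A / (2 * w) * of_real s = complex_of_real F"
      by (simp add: w_def c_def s_def F_def)
    ultimately show ?thesis
      using truncated_solution_right[OF that(1) w0 \<open>L > 0\<close> N that(2,3)]
      by (simp add: p11_def p12_def p21_def p22_def U_def V_def of_real_cheb_U w_def)
  qed
  have neg: "{..<0} \<inter> ?P = {}" using \<open>L > 0\<close> by (auto simp: truncated_lattice_def mult_less_0_iff)
  define t where "t = \<tau> * exp (- \<i> * w * of_real (real N * L))"
  have t\<tau>: "t * exp (\<i> * w * of_real (real N * L)) = \<tau>"
    by (simp add: t_def flip: exp_add)
  have "transmission A L N \<omega> = t"
    unfolding transmission_def w_def[symmetric]
  proof (rule the_equality)
    \<comment> \<open>The first component of p^-1 (\<tau>, \<i> \<tau>) is to be 1 + r; the relation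
      \<tau> d = 2 makes the second one equal to \<i> (1 - r).\<close>
    define r where "r = (p22 - \<i> * p12) * \<tau> - 1"
    have "\<i> * (1 - r) = \<i> * (\<tau> * d - (p22 - \<i> * p12) * \<tau>)" unfolding \<tau>d r_def by simp
    also have "\<dots> = (\<i> * p11 - p21) * \<tau>" unfolding d_eq by (simp add: algebra_simps)
    finally have r2: "\<i> * (1 - r) = (\<i> * p11 - p21) * \<tau>" .
    obtain \<psi> \<psi>' where sol: "delta_solution_with A ?P (w\<^sup>2) \<psi> \<psi>'"
      and \<psi>0: "\<psi> 0 = 1 + r" "(\<psi>' \<longlongrightarrow> w * (\<i> * (1 - r))) (at_left 0)"
      by (rule delta_solution_exists[OF \<open>L > 0\<close> truncated_lattice_subset w0])
    have "\<psi> x = exp (\<i> * w * of_real x) + r * exp (- \<i> * w * of_real x)" if "x < 0" for x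
    proof -
      obtain \<alpha> \<beta> where ab: "\<And>x. x \<in> {..<0} \<Longrightarrow> \<psi> x = wave w 0 \<alpha> \<beta> x"
        "\<And>x. x \<in> {..<0} \<Longrightarrow> \<psi>' x = w * wave w 0 \<beta> (- \<alpha>) x"
        using solution_is_wave[OF sol w0 _ neg, where p = 0] by (metis convex_real_interval(4))
      have "(\<psi> \<longlongrightarrow> \<psi> 0) (at_left 0)"
        using sol unfolding delta_solution_with_def
        by (simp add: continuous_on_eq_continuous_at isCont_def filterlim_at_split)
      moreover have "(\<psi> \<longlongrightarrow> wave w 0 \<alpha> \<beta> 0) (at_left 0)"
        by (rule Lim_transform_within[OF tendsto_wave_at[of w 0 \<alpha> \<beta>], of 1]) (auto simp: ab)
      ultimately have "\<alpha> = 1 + r" using \<psi>0(1)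
        by (metis tendsto_unique trivial_limit_at_left_real wave_at)
      moreover have "(\<psi>' \<longlongrightarrow> w * wave w 0 \<beta> (- \<alpha>) 0) (at_left 0)"
        by (rule Lim_transform_within[OF tendsto_mult[OF tendsto_const tendsto_wave_at[of w 0]], of 1])
           (auto simp: ab)
      then have "w * \<beta> = w * (\<i> * (1 - r))" using \<psi>0(2)
        by (metis tendsto_unique trivial_limit_at_left_real wave_at)
      ultimately show ?thesis using ab(1)[of x] that w0 wave_exp[of 1 w x r] by simp
    qed
    moreover have "\<psi> x = t * exp (\<i> * w * of_real x)" if "x > real N * L" for x
    proof -
      have "p11 * \<psi> 0 + p12 * (\<i> * (1 - r)) = (complex_of_real p11 * p22 - of_real p12 * p21) * \<tau>"
        unfolding \<psi>0(1) r2 by (simp add: r_def algebra_simps)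
      moreover have "p21 * \<psi> 0 + p22 * (\<i> * (1 - r)) = (complex_of_real p11 * p22 - of_real p12 * p21) * (\<i> * \<tau>)"
        unfolding \<psi>0(1) r2 by (simp add: r_def algebra_simps)
      ultimately have "\<psi> x = wave w (real N * L) \<tau> (\<i> * \<tau>) x"
        using right[OF sol \<psi>0(2) that] unfolding detc by simp
      then show ?thesis using wave_exp_shift[of t w x "real N * L"] unfolding t\<tau> by simp
    qed
    ultimately show "\<exists>r \<psi>. delta_solution A ?P (w\<^sup>2) \<psi> \<and>
       (\<forall>x<0. \<psi> x = exp (\<i> * w * of_real x) + r * exp (- \<i> * w * of_real x)) \<and>
       (\<forall>x>real N * L. \<psi> x = t * exp (\<i> * w * of_real x))"
      using sol unfolding delta_solution_iff by blast
  next
    fix t'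
    assume "\<exists>r \<psi>. delta_solution A ?P (w\<^sup>2) \<psi> \<and>
       (\<forall>x<0. \<psi> x = exp (\<i> * w * of_real x) + r * exp (- \<i> * w * of_real x)) \<and>
       (\<forall>x>real N * L. \<psi> x = t' * exp (\<i> * w * of_real x))"
    then obtain r \<psi> \<psi>' where sol: "delta_solution_with A ?P (w\<^sup>2) \<psi> \<psi>'"
      and l: "\<And>x. x < 0 \<Longrightarrow> \<psi> x = exp (\<i> * w * of_real x) + r * exp (- \<i> * w * of_real x)"
      and r: "\<And>x. x > real N * L \<Longrightarrow> \<psi> x = t' * exp (\<i> * w * of_real x)"
      unfolding delta_solution_iff by blast
    define \<sigma> where "\<sigma> = t' * exp (\<i> * w * of_real (real N * L))"
    \<comment> \<open>Uniqueness: the incoming side determines the data at 0-, the N-period matrix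
      propagates them, and comparing value and derivative with the outgoing wave at N L gives two
      equations for r and \<sigma>.\<close>
    have l': "\<psi> x = wave w 0 (1 + r) (\<i> * (1 - r)) x" if "x \<in> {..<0}" for x
      using l[of x] wave_exp[of 1 w x r] that by simp
    have r': "\<psi> x = wave w (real N * L) \<sigma> (\<i> * \<sigma>) x" if "x \<in> {real N * L<..}" for x
      using r[of x] wave_exp_shift[of t' w x "real N * L"] that by (simp add: \<sigma>_def)
    have ctsl: "(\<psi> \<longlongrightarrow> \<psi> p) (at_left p)" and ctsr: "(\<psi> \<longlongrightarrow> \<psi> p) (at_right p)" for p
      using sol unfolding delta_solution_with_def
      by (simp_all add: continuous_on_eq_continuous_at isCont_def filterlim_at_split)
    have "(\<psi> \<longlongrightarrow> wave w 0 (1 + r) (\<i> * (1 - r)) 0) (at_left 0)"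
      by (rule Lim_transform_within[OF tendsto_wave_at[of w 0], of 1]) (auto simp: l')
    then have \<psi>0: "\<psi> 0 = 1 + r"
      using ctsl by (metis tendsto_unique trivial_limit_at_left_real wave_at)
    have lim0: "(\<psi>' \<longlongrightarrow> w * (\<i> * (1 - r))) (at_left 0)"
    proof -
      have "\<psi>' x = w * wave w 0 (\<i> * (1 - r)) (- (1 + r)) x" if "x \<in> {..<0}" for x
        by (rule solution_deriv_wave[OF sol _ neg l' that]) auto
      then have "(\<psi>' \<longlongrightarrow> w * wave w 0 (\<i> * (1 - r)) (- (1 + r)) 0) (at_left 0)"
        by (intro Lim_transform_within[OF tendsto_mult[OF tendsto_const tendsto_wave_at[of w 0]], of 1])
           auto
      then show ?thesis by simp
    qed
    define X where "X = p11 * \<psi> 0 + p12 * (\<i> * (1 - r))"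
    define Y where "Y = p21 * \<psi> 0 + p22 * (\<i> * (1 - r))"
    note R = right[OF sol lim0, folded X_def Y_def]
    have pos: "{real N * L<..} \<inter> ?P = {}" using \<open>L > 0\<close> by (auto simp: truncated_lattice_def)
    have R': "\<psi>' x = w * wave w (real N * L) (\<i> * \<sigma>) (- \<sigma>) x" if "x \<in> {real N * L<..}" for x
      by (rule solution_deriv_wave[OF sol _ pos r' that]) auto
    have "(\<psi> \<longlongrightarrow> wave w (real N * L) \<sigma> (\<i> * \<sigma>) (real N * L)) (at_right (real N * L))"
      by (rule Lim_transform_within[OF tendsto_wave_at[of w "real N * L"], of 1]) (auto simp: r')
    moreover have "(\<psi> \<longlongrightarrow> wave w (real N * L) X Y (real N * L)) (at_right (real N * L))"
      by (rule Lim_transform_within[OF tendsto_wave_at[of w "real N * L"], of 1]) (auto simp: R)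
    ultimately have X: "X = \<sigma>"
      by (metis tendsto_unique trivial_limit_at_right_real wave_at)
    have "(\<psi>' \<longlongrightarrow> w * wave w (real N * L) (\<i> * \<sigma>) (- \<sigma>) (real N * L)) (at_right (real N * L))"
      by (rule Lim_transform_within[OF tendsto_mult[OF tendsto_const tendsto_wave_at[of w "real N * L"]], of 1])
        (auto simp: R')
    moreover have "(\<psi>' \<longlongrightarrow> w * wave w (real N * L) Y (- X) (real N * L)) (at_right (real N * L))"
      by (rule Lim_transform_within[OF tendsto_mult[OF tendsto_const tendsto_wave_at[of w "real N * L"]], of 1])
        (auto simp: R)
    ultimately have "w * Y = w * (\<i> * \<sigma>)"
      by (metis tendsto_unique trivial_limit_at_right_real wave_at)
    then have Y: "Y = \<i> * \<sigma>" using w0 by simp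
    have "p22 * X - p12 * Y = (complex_of_real p11 * p22 - of_real p12 * p21) * \<psi> 0"
      "p11 * Y - p21 * X = (complex_of_real p11 * p22 - of_real p12 * p21) * (\<i> * (1 - r))"
      by (simp_all add: X_def Y_def algebra_simps)
    then have "(p22 - \<i> * p12) * \<sigma> = 1 + r" "(\<i> * p11 - p21) * \<sigma> = \<i> * (1 - r)"
      unfolding X Y detc \<psi>0 by (simp_all add: algebra_simps)
    \<comment> \<open>The combination of the two equations in which r cancels.\<close>
    then have "(p22 - \<i> * p12) * \<sigma> - \<i> * ((\<i> * p11 - p21) * \<sigma>) = 1 + r - \<i> * (\<i> * (1 - r))"
      by simp
    then have "\<sigma> * d = 2" unfolding d_eq by (simp add: algebra_simps)
    then have "\<sigma> = \<tau>" using d0 \<tau>d by (metis mult_right_cancel)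
    then show "t' = t" using t\<tau> unfolding \<sigma>_def by (metis exp_not_eq_zero mult_right_cancel)
  qed
  then have "cmod (transmission A L N \<omega>) = cmod \<tau>"
    by (simp add: t_def norm_mult w_def)
  also have "\<dots> = 1 / sqrt (1 + (A / (2 * \<omega>) * U)\<^sup>2)"
    by (simp add: \<tau>_def norm_divide cd)
  finally show ?thesis by (simp add: U_def)
qed

section \<open>Roots of the Chebyshev polynomials\<close>

text \<open>This is x \<le> tan x with the denominator cleared, which extends it beyond pi / 2. The
  difference has derivative t sin t.\<close>

lemma mult_cos_le_sin:
  fixes x :: real
  assumes "0 \<le> x" "x \<le> pi"
  shows "x * cos x \<le> sin x"
proof -
  have "sin 0 - 0 * cos 0 \<le> sin x - x * cos (x::real)"
  proof (rule DERIV_nonneg_imp_nondecreasing[OF \<open>0 \<le> x\<close>])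
    fix t assume "0 \<le> t" "t \<le> x"
    then have "t * sin t \<ge> 0" using \<open>x \<le> pi\<close> by (intro mult_nonneg_nonneg sin_ge_zero) auto
    moreover have "((\<lambda>x. sin x - x * cos x) has_real_derivative t * sin t) (at t)"
      by (auto intro!: derivative_eq_intros)
    ultimately show "\<exists>y. ((\<lambda>x. sin x - x * cos x) has_real_derivative y) (at t) \<and> y \<ge> 0" by blast
  qed
  then show ?thesis by simp
qed

text \<open>A weak form of Jordan's inequality, obtained from x / 2 \<le> tan (x / 2) by doubling
  the angle.\<close>

lemma half_le_sin:
  fixes x :: real
  assumes "0 \<le> x" "x \<le> pi / 2"
  shows "x / 2 \<le> sin x"
proof -
  have "x / 2 * cos (x / 2) * cos (x / 2) \<le> sin (x / 2) * cos (x / 2)"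
    using assms by (intro mult_right_mono mult_cos_le_sin cos_ge_zero) auto
  then have "x * (cos (x / 2))\<^sup>2 \<le> sin x"
    using sin_double[of "x / 2"] by (simp add: power2_eq_square)
  moreover have "(cos (x / 2))\<^sup>2 = (1 + cos x) / 2"
    using cos_double_cos[of "x / 2"] by simp
  ultimately have "x * (1 + cos x) / 2 \<le> sin x" by simp
  moreover have "x * (1 + cos x) \<ge> x * 1"
    using assms by (intro mult_left_mono) (auto intro: cos_ge_zero)
  ultimately show ?thesis by simp
qed

lemma half_le_abs_sin: "\<bar>x\<bar> \<le> pi / 2 \<Longrightarrow> \<bar>x\<bar> / 2 \<le> \<bar>sin x\<bar>" for x :: real
  using half_le_sin[of x] half_le_sin[of "- x"] by (cases "x \<ge> 0") auto

lemma one_minus_cos_le: "1 - cos x \<le> x\<^sup>2 / 2" for x :: real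
proof -
  have "(sin (x / 2))\<^sup>2 \<le> (x / 2)\<^sup>2"
    using abs_sin_x_le_abs_x[of "x / 2"] by (simp only: abs_le_square_iff)
  then show ?thesis using cos_double_sin[of "x / 2"] by (simp add: power_divide)
qed

lemma minus_sin_le_square:
  fixes x :: real
  assumes "0 \<le> x" "x \<le> 2"
  shows "x - sin x \<le> x\<^sup>2"
proof -
  have "x - sin x \<le> x * (1 - cos x)"
    using mult_cos_le_sin[of x] assms pi_gt3 by (simp add: algebra_simps)
  also have "\<dots> \<le> x * (x\<^sup>2 / 2)" using assms by (intro mult_left_mono one_minus_cos_le)
  also have "\<dots> = x\<^sup>2 * (x / 2)" by (simp add: power2_eq_square)
  also have "\<dots> \<le> x\<^sup>2 * 1" using assms by (intro mult_left_mono) auto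
  finally show ?thesis by simp
qed

text \<open>Before N \<kappa> reaches pi / 2 there is no root, since sin N\<kappa> \<ge> N\<kappa> /
  2 \<ge> \<kappa> / 2 \<ge> (sin \<kappa>) / 2.\<close>

lemma half_le_abs_cheb_U_cos:
  assumes "0 \<le> \<kappa>" "real N * \<kappa> \<le> pi / 2" "N \<ge> 1"
  shows "1 / 2 \<le> \<bar>cheb_U N (cos \<kappa>)\<bar>"
proof (cases "\<kappa> = 0")
  case True
  then show ?thesis using \<open>N \<ge> 1\<close> by (simp add: cheb_U_1)
next
  case False
  have N\<kappa>: "\<kappa> \<le> real N * \<kappa>" using assms mult_right_mono[of 1 "real N" \<kappa>] by simp
  then have "0 < \<kappa>" "\<kappa> \<le> pi / 2" using assms False by linarith+
  then have s: "0 < sin \<kappa>" "sin \<kappa> \<le> \<kappa>" by (auto intro!: sin_gt_zero sin_x_le_x)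
  have "1 / 2 * sin \<kappa> \<le> real N * \<kappa> / 2" using s(2) N\<kappa> by linarith
  also have "\<dots> \<le> sin (real N * \<kappa>)" using assms by (intro half_le_sin) auto
  also have "\<dots> \<le> \<bar>cheb_U N (cos \<kappa>)\<bar> * sin \<kappa>"
    using s(1) by (simp flip: cheb_U_cos)
  finally show ?thesis using s(1) by simp
qed

text \<open>With y = cos \<kappa>, let j pi be the multiple of pi nearest to N\<kappa>. For 0 < j <
  N the sine grows at least like half the distance from j pi, the cosine is 1-Lipschitz, and
  dividing by sin \<kappa> only helps. At j = 0 and j = N the zero of sin N\<kappa> is cancelled by
  that of sin \<kappa>, so these two values give the constant bound.\<close>

lemma abs_cheb_U_ge:
  fixes y :: real
  assumes "-1 \<le> y" "y \<le> 1" "N \<ge> 1"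
  shows "1 / 2 \<le> \<bar>cheb_U N y\<bar> \<or> (\<exists>j\<in>{1..<N}. \<bar>y - cos (real j * pi / real N)\<bar> / 2 \<le> \<bar>cheb_U N y\<bar>)"
proof -
  define \<kappa> where "\<kappa> = arccos y"
  have y: "y = cos \<kappa>" and \<kappa>: "0 \<le> \<kappa>" "\<kappa> \<le> pi"
    using assms by (auto simp: \<kappa>_def arccos_lbound arccos_ubound)
  define i where "i = round (real N * \<kappa> / pi)"
  define j where "j = nat i"
  have "\<bar>of_int i - real N * \<kappa> / pi\<bar> \<le> 1 / 2" unfolding i_def by (rule of_int_round_abs_le)
  then have "\<bar>(of_int i - real N * \<kappa> / pi) * pi\<bar> \<le> 1 / 2 * pi"
    unfolding abs_mult by (intro mult_mono) auto
  then have i: "\<bar>of_int i * pi - real N * \<kappa>\<bar> \<le> pi / 2" by (simp add: left_diff_distrib)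
  have "real N * \<kappa> / pi \<ge> 0" using \<kappa> by simp
  then have "i \<ge> 0" unfolding i_def by (simp add: round_def)
  have N\<kappa>: "real N * \<kappa> \<le> real N * pi" using \<kappa> by (intro mult_left_mono) auto
  then have "real N * \<kappa> / pi \<le> real N" by (simp add: field_simps)
  then have "i \<le> int N" unfolding i_def by (metis round_mono round_of_nat)
  have j: "\<bar>real j * pi - real N * \<kappa>\<bar> \<le> pi / 2" "j \<le> N"
    using i \<open>i \<ge> 0\<close> \<open>i \<le> int N\<close> by (auto simp: j_def)
  consider "j = 0" | "j = N" | "j \<in> {1..<N}" using j(2) by fastforce
  then show ?thesis
  proof cases
    case 1
    then show ?thesis using half_le_abs_cheb_U_cos[of \<kappa> N] \<kappa> j(1) \<open>N \<ge> 1\<close> y by simp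
  next
    case 2
    \<comment> \<open>Reflecting \<kappa> to pi - \<kappa> moves the end j = N to the end already
      treated; parity of the polynomial absorbs the sign.\<close>
    have "real N * (pi - \<kappa>) \<le> pi / 2" unfolding right_diff_distrib using j(1)[unfolded 2] by linarith
    then have "1 / 2 \<le> \<bar>cheb_U N (cos (pi - \<kappa>))\<bar>"
      using \<kappa> \<open>N \<ge> 1\<close> by (intro half_le_abs_cheb_U_cos) auto
    moreover have "cos (pi - \<kappa>) = - y" by (simp add: y cos_diff)
    ultimately show ?thesis by (simp add: cheb_U_minus abs_mult)
  next
    case 3
    have N: "real N > 0" using \<open>N \<ge> 1\<close> by simp
    define x where "x = real N * \<kappa> - real j * pi"
    have x_eq: "x = real N * (\<kappa> - real j * pi / real N)"
      using N by (simp add: x_def right_diff_distrib)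
    have "\<bar>y - cos (real j * pi / real N)\<bar> \<le> \<bar>\<kappa> - real j * pi / real N\<bar>"
    proof -
      have "\<bar>cos \<kappa> - cos (real j * pi / real N)\<bar>
        = 2 * (\<bar>sin ((\<kappa> + real j * pi / real N) / 2)\<bar> * \<bar>sin ((real j * pi / real N - \<kappa>) / 2)\<bar>)"
        by (simp add: cos_diff_cos abs_mult)
      also have "\<dots> \<le> 2 * (1 * \<bar>(real j * pi / real N - \<kappa>) / 2\<bar>)"
        by (intro mult_left_mono mult_mono abs_sin_le_one abs_sin_x_le_abs_x) auto
      finally show ?thesis by (simp add: y)
    qed
    also have "\<dots> \<le> real N * \<bar>\<kappa> - real j * pi / real N\<bar>"
      using \<open>N \<ge> 1\<close> mult_right_mono[of 1 "real N" "\<bar>\<kappa> - real j * pi / real N\<bar>"] by simp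
    also have "\<dots> = \<bar>x\<bar>" unfolding x_eq by (simp add: abs_mult)
    also have "\<dots> \<le> 2 * \<bar>sin x\<bar>"
      using half_le_abs_sin[of x] j(1) by (simp add: x_def abs_minus_commute)
    also have "\<bar>sin x\<bar> = \<bar>sin (real N * \<kappa>)\<bar>"
      by (simp add: x_def sin_diff abs_mult)
    also have "\<dots> = \<bar>cheb_U N y\<bar> * \<bar>sin \<kappa>\<bar>" by (simp add: y abs_mult flip: cheb_U_cos)
    also have "\<dots> \<le> \<bar>cheb_U N y\<bar> * 1" by (intro mult_left_mono) auto
    finally have "\<bar>y - cos (real j * pi / real N)\<bar> / 2 \<le> \<bar>cheb_U N y\<bar>" by simp
    with 3 show ?thesis by blast
  qed
qed

text \<open>That there are no further roots follows from the lower bound: where the polynomial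
  vanishes, the distance to one of the listed points must vanish too.\<close>

lemma cheb_U_root_iff:
  fixes y :: real
  assumes "N \<ge> 1"
  shows "-1 \<le> y \<and> y \<le> 1 \<and> cheb_U N y = 0 \<longleftrightarrow> (\<exists>j\<in>{1..<N}. y = cos (real j * pi / real N))"
proof
  assume "-1 \<le> y \<and> y \<le> 1 \<and> cheb_U N y = 0"
  then show "\<exists>j\<in>{1..<N}. y = cos (real j * pi / real N)"
    using abs_cheb_U_ge[of y N] assms by auto
next
  assume "\<exists>j\<in>{1..<N}. y = cos (real j * pi / real N)"
  then obtain j where j: "j \<in> {1..<N}" and y: "y = cos (real j * pi / real N)" by blast
  have "real N * (real j * pi / real N) = real j * pi" using j by simp
  then have "cheb_U N y * sin (real j * pi / real N) = 0"
    unfolding y cheb_U_cos by (simp only: sin_npi)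
  moreover have "sin (real j * pi / real N) > 0"
    using j by (intro sin_gt_zero) (auto simp: field_simps)
  ultimately show "-1 \<le> y \<and> y \<le> 1 \<and> cheb_U N y = 0" by (simp add: y)
qed

lemma cheb_U_pm1_neq_0:
  fixes y :: real
  assumes "N \<ge> 1" "y\<^sup>2 = 1"
  shows "cheb_U N y \<noteq> 0"
proof -
  have "y = 1 \<or> y = -1" using assms(2) by (simp add: power2_eq_1_iff)
  then show ?thesis using assms(1) cheb_U_minus[of N "1::real"]
    by (cases "even N") (auto simp: cheb_U_1)
qed

lemma card_cheb_U_roots:
  assumes "N \<ge> 1"
  shows "finite {y::real. -1 \<le> y \<and> y \<le> 1 \<and> cheb_U N y = 0}"
    and "card {y::real. -1 \<le> y \<and> y \<le> 1 \<and> cheb_U N y = 0} = N - 1"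
proof -
  have eq: "{y::real. -1 \<le> y \<and> y \<le> 1 \<and> cheb_U N y = 0} = (\<lambda>j. cos (real j * pi / real N)) ` {1..<N}"
    by (simp only: cheb_U_root_iff[OF assms] image_def)
  have "inj_on (\<lambda>j. cos (real j * pi / real N)) {1..<N}"
  proof (rule inj_onI)
    fix i j assume ij: "i \<in> {1..<N}" "j \<in> {1..<N}"
      and eq: "cos (real i * pi / real N) = cos (real j * pi / real N)"
    have "real j * pi / real N \<le> pi" if "j \<in> {1..<N}" for j
      using that mult_right_mono[of "real j" "real N" pi] by (simp add: pos_divide_le_eq mult.commute)
    then have "real i * pi / real N = real j * pi / real N"
      using ij by (intro cos_inj_pi[OF _ _ _ _ eq]) simp_all
    then show "i = j" using assms by simp
  qed
  then show "card {y::real. -1 \<le> y \<and> y \<le> 1 \<and> cheb_U N y = 0} = N - 1"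
    unfolding eq by (simp add: card_image)
  show "finite {y::real. -1 \<le> y \<and> y \<le> 1 \<and> cheb_U N y = 0}" unfolding eq by simp
qed

section \<open>Half the trace of the monodromy matrix\<close>

text \<open>The Kronig-Penney function, i.e. the half trace in the variables \<open>\<theta>\<close>
  = \<omega> L and \<open>a\<close> = A L / 2, which eliminate the period.\<close>

definition kp :: "real \<Rightarrow> real \<Rightarrow> real" where
  "kp a \<theta> = cos \<theta> + a / \<theta> * sin \<theta>"

definition kp_deriv :: "real \<Rightarrow> real \<Rightarrow> real" where
  "kp_deriv a \<theta> = - sin \<theta> + a / \<theta> * cos \<theta> - a / \<theta>\<^sup>2 * sin \<theta>"

lemma has_real_derivative_kp:
  "\<theta> > 0 \<Longrightarrow> (kp a has_real_derivative kp_deriv a \<theta>) (at \<theta>)"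
  unfolding kp_def[abs_def] kp_deriv_def
  by (auto intro!: derivative_eq_intros simp: power2_eq_square field_simps)

lemma half_trace_kp:
  assumes "L > 0" "\<omega> > 0"
  shows "half_trace A L (complex_of_real \<omega>) = of_real (kp (A * L / 2) (\<omega> * L))"
proof -
  have "half_trace A L (complex_of_real \<omega>)
    = cos (complex_of_real (\<omega> * L)) + of_real (A / (2 * \<omega>)) * sin (complex_of_real (\<omega> * L))"
    using half_trace_eq[of L "of_real \<omega>" A] assms by simp
  also have "\<dots> = of_real (cos (\<omega> * L) + A / (2 * \<omega>) * sin (\<omega> * L))"
    unfolding cos_of_real sin_of_real by simp
  finally show ?thesis using assms by (simp add: kp_def)
qed

context
  fixes n :: nat and a :: real
  assumes n: "n \<ge> 1" and a: "a > 0"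
begin

lemma cos_below_npi: "(-1) ^ n * cos (real n * pi - d) = cos d"
  by (simp add: cos_diff flip: power_mult_distrib mult.assoc power_add)

lemma sin_below_npi: "(-1) ^ n * sin (real n * pi - d) = - sin d"
  by (simp add: sin_diff flip: power_mult_distrib mult.assoc power_add)

lemma below_npi_pos: "d < pi \<Longrightarrow> real n * pi - d > 0"
proof -
  assume "d < pi"
  moreover have "pi \<le> real n * pi" using n mult_right_mono[of 1 "real n" pi] by simp
  ultimately show ?thesis by linarith
qed

text \<open>The sign (-1)^n removes the parity of the band: in the variable \<open>d\<close> every
  band shows the same picture, a decrease from 1 at \<open>d = 0\<close> to -1 at the other
  end.\<close>

lemma signed_kp: "(-1) ^ n * kp a (real n * pi - d) = cos d - a / (real n * pi - d) * sin d"
proof -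
  have "(-1) ^ n * kp a (real n * pi - d) = (-1) ^ n * cos (real n * pi - d)
    + a / (real n * pi - d) * ((-1) ^ n * sin (real n * pi - d))"
    by (simp add: kp_def algebra_simps)
  then show ?thesis by (simp add: cos_below_npi sin_below_npi)
qed

lemma signed_kp_deriv:
  "(-1) ^ n * kp_deriv a (real n * pi - d)
     = sin d + a / (real n * pi - d) * cos d + a / (real n * pi - d)\<^sup>2 * sin d"
proof -
  have "(-1) ^ n * kp_deriv a (real n * pi - d) = - ((-1) ^ n * sin (real n * pi - d))
    + a / (real n * pi - d) * ((-1) ^ n * cos (real n * pi - d))
    - a / (real n * pi - d)\<^sup>2 * ((-1) ^ n * sin (real n * pi - d))"
    by (simp add: kp_deriv_def algebra_simps)
  then show ?thesis by (simp add: cos_below_npi sin_below_npi)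
qed

text \<open>
  For \<open>0 \<le> d < \<pi>\<close> the sign of this function decides whether \<open>\<theta> = n \<pi> - d\<close> lies in a band:
  \<open>1 + (-1)^n kp a \<theta>\<close> is a positive multiple of it, while \<open>(-1)^n kp a \<theta> \<le> 1\<close> always holds.
\<close>

definition edge_fun :: "real \<Rightarrow> real" where
  "edge_fun d = (real n * pi - d) * cos (d / 2) - a * sin (d / 2)"

lemma edge_fun_strict_antimono:
  assumes "0 \<le> d" "d < d'" "d' \<le> pi"
  shows "edge_fun d' < edge_fun d"
proof -
  have "pi \<le> real n * pi" using n mult_right_mono[of 1 "real n" pi] by simp
  then have 0: "real n * pi - d' \<ge> 0" using assms by linarith
  have "cos (d' / 2) \<le> cos (d / 2)"
    using assms by (intro cos_monotone_0_pi_le) auto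
  then have "(real n * pi - d') * cos (d' / 2) \<le> (real n * pi - d) * cos (d / 2)"
    using assms 0 by (intro mult_mono cos_ge_zero) auto
  moreover have "sin (d / 2) < sin (d' / 2)"
    using assms by (intro sin_monotone_2pi) auto
  then have "a * sin (d / 2) < a * sin (d' / 2)" using a by simp
  ultimately show ?thesis unfolding edge_fun_def by linarith
qed

text \<open>The d_n of the overview: the width of the n-th band in the variable \<theta>.\<close>

definition edge :: real where
  "edge = (THE d. 0 < d \<and> d < pi \<and> edge_fun d = 0)"

lemma edge: "0 < edge" "edge < pi" "edge_fun edge = 0"
proof -
  have "continuous_on {0..pi} edge_fun"
    unfolding edge_fun_def[abs_def] by (intro continuous_intros) auto
  moreover have "edge_fun 0 > 0" "edge_fun pi < 0" using n a by (auto simp: edge_fun_def)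
  ultimately obtain d where d: "0 \<le> d" "d \<le> pi" "edge_fun d = 0"
    using IVT2'[of edge_fun pi 0 0] by (auto simp: less_imp_le)
  moreover from this have "d \<noteq> 0" "d \<noteq> pi" using \<open>edge_fun 0 > 0\<close> \<open>edge_fun pi < 0\<close> by auto
  ultimately have ex: "0 < d \<and> d < pi \<and> edge_fun d = 0" by auto
  have "\<exists>!d. 0 < d \<and> d < pi \<and> edge_fun d = 0"
  proof (rule ex1I[of _ d])
    show "0 < d \<and> d < pi \<and> edge_fun d = 0" by (rule ex)
  next
    fix d' assume d': "0 < d' \<and> d' < pi \<and> edge_fun d' = 0"
    then show "d' = d"
      using ex edge_fun_strict_antimono[of d d'] edge_fun_strict_antimono[of d' d]
      by (cases d d' rule: linorder_cases) auto
  qed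
  from theI'[OF this] show "0 < edge" "edge < pi" "edge_fun edge = 0" unfolding edge_def by auto
qed

lemma edge_fun_nonneg_iff: "0 \<le> d \<Longrightarrow> d < pi \<Longrightarrow> edge_fun d \<ge> 0 \<longleftrightarrow> d \<le> edge"
  using edge edge_fun_strict_antimono[of d edge] edge_fun_strict_antimono[of edge d]
  by (cases d edge rule: linorder_cases) auto

text \<open>1 + cos d and sin d share the factor 2 cos (d / 2), which is positive for 0 \<le> d <
  pi; what remains is the edge function.\<close>

lemma one_plus_signed_kp:
  assumes "d < pi"
  shows "1 + (-1) ^ n * kp a (real n * pi - d) = 2 * cos (d / 2) / (real n * pi - d) * edge_fun d"
proof -
  have "cos d = 2 * (cos (d / 2))\<^sup>2 - 1" "sin d = 2 * sin (d / 2) * cos (d / 2)"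
    using cos_double_cos[of "d / 2"] sin_double[of "d / 2"] by simp_all
  moreover have "real n * pi - d \<noteq> 0" using below_npi_pos[OF assms] by simp
  ultimately show ?thesis
    unfolding signed_kp edge_fun_def by (simp add: divide_simps) (simp add: algebra_simps power2_eq_square)
qed

lemma one_minus_signed_kp:
  "1 - (-1) ^ n * kp a (real n * pi - d)
     = 2 * sin (d / 2) * (sin (d / 2) + a / (real n * pi - d) * cos (d / 2))"
proof -
  have "cos d = 1 - 2 * (sin (d / 2))\<^sup>2" "sin d = 2 * sin (d / 2) * cos (d / 2)"
    using cos_double_sin[of "d / 2"] sin_double[of "d / 2"] by simp_all
  then show ?thesis
    unfolding signed_kp by (simp add: algebra_simps power2_eq_square)
qed

lemma signed_kp_le_1: "0 \<le> d \<Longrightarrow> d < pi \<Longrightarrow> (-1) ^ n * kp a (real n * pi - d) \<le> 1"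
proof -
  assume d: "0 \<le> d" "d < pi"
  have "0 \<le> 2 * sin (d / 2) * (sin (d / 2) + a / (real n * pi - d) * cos (d / 2))"
    using d a below_npi_pos[OF d(2)]
    by (intro mult_nonneg_nonneg add_nonneg_nonneg sin_ge_zero cos_ge_zero) auto
  then show ?thesis using one_minus_signed_kp[of d] by simp
qed

lemma abs_kp_le_1_iff:
  assumes "0 \<le> d" "d < pi"
  shows "\<bar>kp a (real n * pi - d)\<bar> \<le> 1 \<longleftrightarrow> d \<le> edge"
proof -
  have "\<bar>kp a (real n * pi - d)\<bar> = \<bar>(-1) ^ n * kp a (real n * pi - d)\<bar>" by (simp add: abs_mult)
  also have "\<dots> \<le> 1 \<longleftrightarrow> 0 \<le> 1 + (-1) ^ n * kp a (real n * pi - d)"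
    using signed_kp_le_1[OF assms] by (auto simp: abs_le_iff)
  also have "\<dots> \<longleftrightarrow> 0 \<le> edge_fun d"
  proof -
    have "0 < 2 * cos (d / 2) / (real n * pi - d)"
      using assms below_npi_pos[of d] by (intro divide_pos_pos mult_pos_pos cos_gt_zero_pi) auto
    then show ?thesis unfolding one_plus_signed_kp[OF assms(2)]
      by (metis mult_le_cancel_left_pos mult_zero_right)
  qed
  also have "\<dots> \<longleftrightarrow> d \<le> edge" using assms by (rule edge_fun_nonneg_iff)
  finally show ?thesis .
qed

lemma signed_kp_edge: "(-1) ^ n * kp a (real n * pi - edge) = -1"
  using one_plus_signed_kp[OF edge(2)] edge(3) by simp

lemma signed_kp_npi: "(-1) ^ n * kp a (real n * pi) = 1"
  using one_minus_signed_kp[of 0] by simp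

text \<open>For small \<open>a\<close> the band can reach beyond \<open>d\<close> = pi / 2, where
  the term (a / \<theta>) cos d is negative. The band condition a s \<le> \<theta> c bounds its
  negative part (a / \<theta>) s^2 by s c, which is less than what sin d = 2 s c contributes, or
  equal to it at \<open>d = 0\<close>.\<close>

lemma signed_kp_deriv_pos:
  assumes "0 \<le> d" "d \<le> edge"
  shows "(-1) ^ n * kp_deriv a (real n * pi - d) > 0"
proof -
  define \<theta> where "\<theta> = real n * pi - d"
  define s where "s = sin (d / 2)"
  define c where "c = cos (d / 2)"
  have d: "d < pi" using assms edge by simp
  have \<theta>: "\<theta> > 0" unfolding \<theta>_def using d by (rule below_npi_pos)
  have s: "s \<ge> 0" unfolding s_def using assms d by (intro sin_ge_zero) auto
  have c: "c > 0" unfolding c_def using assms d by (intro cos_gt_zero_pi) auto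
  have "edge_fun d \<ge> 0" using edge_fun_nonneg_iff[of d] assms d by simp
  then have "a * s \<le> \<theta> * c" by (simp add: edge_fun_def \<theta>_def s_def c_def)
  then have gs: "a / \<theta> * s \<le> c" using \<theta> by (simp add: field_simps)
  have cs: "cos d = c\<^sup>2 - s\<^sup>2" "sin d = 2 * s * c"
    using cos_double[of "d / 2"] sin_double[of "d / 2"] by (simp_all add: c_def s_def)
  have "a / \<theta> * s * s \<le> c * s" using gs s by (rule mult_right_mono)
  moreover have "a / \<theta> * (c\<^sup>2 - s\<^sup>2) = a / \<theta> * c\<^sup>2 - a / \<theta> * s * s"
    by (simp add: right_diff_distrib power2_eq_square)
  moreover have "0 \<le> c * s" using s c by simp
  ultimately have "a / \<theta> * c\<^sup>2 \<le> 2 * (c * s) + a / \<theta> * (c\<^sup>2 - s\<^sup>2)" by linarith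
  then have "a / \<theta> * c\<^sup>2 \<le> sin d + a / \<theta> * cos d" unfolding cs by (simp add: mult_ac)
  moreover have "a / \<theta> * c\<^sup>2 > 0" using a \<theta> c by simp
  moreover have "a / \<theta>\<^sup>2 * sin d \<ge> 0" unfolding cs using a s c by simp
  ultimately show ?thesis using signed_kp_deriv[of d] unfolding \<theta>_def[symmetric] by linarith
qed

lemma signed_kp_strict_mono:
  assumes "real n * pi - edge \<le> \<theta>" "\<theta> < \<theta>'" "\<theta>' \<le> real n * pi"
  shows "(-1) ^ n * kp a \<theta> < (-1) ^ n * kp a \<theta>'"
proof (rule DERIV_pos_imp_increasing[OF assms(2)])
  fix t assume t: "\<theta> \<le> t" "t \<le> \<theta>'"
  have "t > 0" using below_npi_pos[OF edge(2)] assms t by simp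
  then have "((\<lambda>x. (-1) ^ n * kp a x) has_real_derivative (-1) ^ n * kp_deriv a t) (at t)"
    by (intro DERIV_cmult has_real_derivative_kp)
  moreover have "(-1) ^ n * kp_deriv a t > 0"
    using signed_kp_deriv_pos[of "real n * pi - t"] assms t by simp
  ultimately show "\<exists>y. ((\<lambda>x. (-1) ^ n * kp a x) has_real_derivative y) (at t) \<and> 0 < y" by blast
qed

text \<open>Each value in [-1, 1] is taken exactly once on a band, so counting transparency points
  becomes counting roots of a polynomial.\<close>

lemma bij_betw_kp: "bij_betw (kp a) {real n * pi - edge..real n * pi} {-1..1}"
proof -
  have mono: "strict_mono_on {real n * pi - edge..real n * pi} (\<lambda>\<theta>. (-1) ^ n * kp a \<theta>)"
    by (intro strict_mono_onI signed_kp_strict_mono) auto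
  have pos: "\<theta> > 0" if "\<theta> \<in> {real n * pi - edge..real n * pi}" for \<theta>
    using that below_npi_pos[OF edge(2)] by auto
  have cont: "continuous_on {real n * pi - edge..real n * pi} (\<lambda>\<theta>. (-1) ^ n * kp a \<theta>)"
    unfolding kp_def by (intro continuous_intros) (use pos in fastforce)
  have "(\<lambda>\<theta>. (-1) ^ n * kp a \<theta>) ` {real n * pi - edge..real n * pi} = {-1..1}"
  proof (intro equalityI subsetI)
    fix y assume "y \<in> (\<lambda>\<theta>. (-1) ^ n * kp a \<theta>) ` {real n * pi - edge..real n * pi}"
    then obtain \<theta> where \<theta>: "\<theta> \<in> {real n * pi - edge..real n * pi}" "y = (-1) ^ n * kp a \<theta>" by blast
    have "\<bar>kp a \<theta>\<bar> \<le> 1" using abs_kp_le_1_iff[of "real n * pi - \<theta>"] \<theta>(1) edge by auto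
    then have "\<bar>y\<bar> \<le> 1" by (simp add: \<theta>(2) abs_mult)
    then show "y \<in> {-1..1}" by (simp add: abs_le_iff)
  next
    fix y :: real assume "y \<in> {-1..1}"
    then show "y \<in> (\<lambda>\<theta>. (-1) ^ n * kp a \<theta>) ` {real n * pi - edge..real n * pi}"
      using IVT'[of "\<lambda>\<theta>. (-1) ^ n * kp a \<theta>" "real n * pi - edge" y "real n * pi"]
        cont edge(1) signed_kp_edge signed_kp_npi by auto
  qed
  then have b: "bij_betw (\<lambda>\<theta>. (-1) ^ n * kp a \<theta>) {real n * pi - edge..real n * pi} {-1..1}"
    using strict_mono_on_imp_inj_on[OF mono] by (simp add: bij_betw_def)
  have "bij_betw (\<lambda>y::real. (-1) ^ n * y) {-1..1} {-1..1}"
    by (rule bij_betwI[of _ _ _ "\<lambda>y::real. (-1) ^ n * y"])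
       (auto simp: minus_one_power_iff)
  from bij_betw_trans[OF b this] show ?thesis
    by (simp add: o_def flip: mult.assoc power_mult_distrib)
qed

section \<open>Width and slope of a band for large a\<close>

text \<open>The edge equation says a tan (edge / 2) = n pi - edge; now use x \<le> tan x.\<close>

lemma edge_le: "edge \<le> 2 * real n * pi / a"
proof -
  have c: "cos (edge / 2) > 0" using edge by (intro cos_gt_zero_pi) auto
  have "a * (edge / 2 * cos (edge / 2)) \<le> a * sin (edge / 2)"
    using edge a by (intro mult_left_mono mult_cos_le_sin) auto
  also have "\<dots> = (real n * pi - edge) * cos (edge / 2)" using edge(3) by (simp add: edge_fun_def)
  also have "\<dots> \<le> real n * pi * cos (edge / 2)" using edge c by (intro mult_right_mono) auto
  finally have "a * edge / 2 * cos (edge / 2) \<le> real n * pi * cos (edge / 2)" by (simp add: algebra_simps)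
  then have "a * edge / 2 \<le> real n * pi" using c by (simp only: mult_le_cancel_right_pos)
  then show ?thesis using a by (simp add: field_simps)
qed

lemma edge_asymp: "\<bar>a * edge / 2 - real n * pi\<bar> \<le> (2 * (real n * pi)\<^sup>2 + 2 * (real n * pi)) / a"
proof -
  define x where "x = edge / 2"
  have x: "0 < x" "x \<le> 2" "x \<le> real n * pi / a"
    using edge edge_le pi_less_4 by (auto simp: x_def mult_ac)
  have ax: "a * x \<le> real n * pi" using x(3) a by (simp add: field_simps)
  \<comment> \<open>The edge equation (n pi - 2x) cos x = a sin x, rearranged so that each term is
    O(1 / a) once x = O(1 / a).\<close>
  have eq: "a * x - real n * pi = a * (x - sin x) - (real n * pi * (1 - cos x) + 2 * x * cos x)"
    using edge(3) by (simp add: edge_fun_def x_def algebra_simps)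
  have "0 \<le> x - sin x" "x - sin x \<le> x\<^sup>2" using x sin_x_le_x minus_sin_le_square by auto
  then have "a * 0 \<le> a * (x - sin x)" "a * (x - sin x) \<le> a * x\<^sup>2"
    using a by (auto intro: mult_left_mono)
  moreover have "a * x\<^sup>2 \<le> (real n * pi)\<^sup>2 / a"
  proof -
    have "a * x * (a * x) \<le> real n * pi * (real n * pi)"
      by (rule mult_mono[OF ax ax]) (use x a in auto)
    then show ?thesis using a by (simp add: field_simps power2_eq_square)
  qed
  moreover have "real n * pi * (1 - cos x) \<le> (real n * pi)\<^sup>2 / a"
  proof -
    have "1 - cos x \<le> x\<^sup>2 / 2" by (rule one_minus_cos_le)
    also have "\<dots> \<le> x" using x mult_right_mono[of x 2 x] by (simp add: power2_eq_square)
    also have "\<dots> \<le> real n * pi / a" by (rule x)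
    finally have "real n * pi * (1 - cos x) \<le> real n * pi * (real n * pi / a)"
      by (intro mult_left_mono) auto
    then show ?thesis by (simp add: power2_eq_square)
  qed
  moreover have "real n * pi * (1 - cos x) \<ge> 0" by simp
  moreover have "cos x > 0" unfolding x_def using edge by (intro cos_gt_zero_pi) auto
  then have "0 \<le> 2 * x * cos x" "2 * x * cos x \<le> 2 * x * 1" using x by auto
  moreover have "2 * x \<le> 2 * (real n * pi) / a" using x(3) by simp
  ultimately have "\<bar>a * x - real n * pi\<bar> \<le> (real n * pi)\<^sup>2 / a + ((real n * pi)\<^sup>2 / a + 2 * (real n * pi) / a)"
    unfolding eq by linarith
  also have "\<dots> = (2 * (real n * pi)\<^sup>2 + 2 * (real n * pi)) / a" by (simp add: add_divide_distrib)
  finally show ?thesis by (simp add: x_def)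
qed

text \<open>The threshold 2 n pi is chosen so that the band width is at most 1. The factor
  \<open>cos edge\<close> is kept in the slope bound because the group velocity needs the exact
  leading constant; elsewhere 1/2 suffices.\<close>

lemma kp_deriv_ge:
  assumes "0 \<le> d" "d \<le> edge" "a \<ge> 2 * real n * pi"
  shows "a / (real n * pi) * cos edge \<le> (-1) ^ n * kp_deriv a (real n * pi - d)" "1 / 2 \<le> cos edge"
    "edge \<le> 1"
proof -
  have "2 * real n * pi / a \<le> 1" using assms(3) a by simp
  with edge_le show e1: "edge \<le> 1" by linarith
  have "edge\<^sup>2 / 2 \<le> 1 / 2" using e1 edge(1) by (simp add: power_le_one)
  with one_minus_cos_le[of edge] show ce: "1 / 2 \<le> cos edge" by linarith
  have d: "d < pi" using assms edge by simp
  have \<theta>: "real n * pi - d > 0" using d by (rule below_npi_pos)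
  have "sin d \<ge> 0" using assms d by (intro sin_ge_zero) auto
  moreover have "a / (real n * pi - d)\<^sup>2 * sin d \<ge> 0" using calculation a by simp
  moreover have "a / (real n * pi) * cos edge \<le> a / (real n * pi - d) * cos d"
  proof (rule mult_mono)
    show "cos edge \<le> cos d" using assms edge by (intro cos_monotone_0_pi_le) auto
    show "a / (real n * pi) \<le> a / (real n * pi - d)"
      using assms a \<theta> by (intro divide_left_mono) auto
  qed (use ce a \<theta> in auto)
  ultimately show "a / (real n * pi) * cos edge \<le> (-1) ^ n * kp_deriv a (real n * pi - d)"
    unfolding signed_kp_deriv by linarith
qed

text \<open>By the mean value theorem the half trace stretches distances by a factor of order
  \<open>a\<close>. Read backwards, closeness of values gives closeness of frequencies.\<close>

lemma kp_expanding:
  assumes "a \<ge> 2 * real n * pi"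
    and "\<theta> \<in> {real n * pi - edge..real n * pi}" "\<theta>' \<in> {real n * pi - edge..real n * pi}"
  shows "a / (2 * real n * pi) * \<bar>\<theta> - \<theta>'\<bar> \<le> \<bar>kp a \<theta> - kp a \<theta>'\<bar>"
proof -
  have less: "a / (2 * real n * pi) * \<bar>\<theta> - \<theta>'\<bar> \<le> \<bar>kp a \<theta> - kp a \<theta>'\<bar>"
    if th: "\<theta> < \<theta>'" "real n * pi - edge \<le> \<theta>" "\<theta>' \<le> real n * pi" for \<theta> \<theta>'
  proof -
    have "\<theta> > 0" using below_npi_pos[OF edge(2)] th by simp
    then obtain z where z: "\<theta> < z" "z < \<theta>'" "kp a \<theta>' - kp a \<theta> = (\<theta>' - \<theta>) * kp_deriv a z"
      using MVT2[OF th(1), of "kp a" "kp_deriv a"] has_real_derivative_kp by force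
    have "a / (real n * pi) * (1 / 2) \<le> a / (real n * pi) * cos edge"
      using a kp_deriv_ge(2)[of 0] edge assms(1) by (intro mult_left_mono) auto
    also have "\<dots> \<le> (-1) ^ n * kp_deriv a z"
      using kp_deriv_ge(1)[of "real n * pi - z"] assms(1) z th by simp
    also have "\<dots> \<le> \<bar>(-1) ^ n * kp_deriv a z\<bar>" by simp
    also have "\<dots> = \<bar>kp_deriv a z\<bar>" by (simp add: abs_mult)
    finally have "a / (2 * real n * pi) * \<bar>\<theta> - \<theta>'\<bar> \<le> \<bar>kp_deriv a z\<bar> * \<bar>\<theta> - \<theta>'\<bar>"
      by (intro mult_right_mono) (auto simp: field_simps)
    also have "\<dots> = \<bar>kp a \<theta>' - kp a \<theta>\<bar>" unfolding z(3) using th(1) by (simp add: abs_mult)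
    finally show ?thesis by (simp add: abs_minus_commute)
  qed
  show ?thesis
    using less[of \<theta> \<theta>'] less[of \<theta>' \<theta>] assms
    by (cases \<theta> \<theta>' rule: linorder_cases) (auto simp: abs_minus_commute)
qed

text \<open>As a * edge / 2 is close to n pi, a sin d is close to 2 u n pi at d = u * edge, so the
  half trace becomes affine in the relative position.\<close>

lemma signed_kp_at_relative_position:
  assumes "a \<ge> 2 * real n * pi" "0 \<le> u" "u \<le> 1"
  shows "\<bar>(-1) ^ n * kp a (real n * pi - u * edge) - (1 - 2 * u)\<bar>
     \<le> (8 * (real n * pi)\<^sup>2 + 10 * (real n * pi)) / a"
proof -
  define d where "d = u * edge"
  define m where "m = real n * pi"
  have m: "m > 0" "m \<ge> 2" using n pi_gt3 mult_mono[of 1 "real n" 3 pi] by (auto simp: m_def)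
  have e: "edge \<le> 1" "0 < edge" "edge \<le> 2 * m / a"
    using kp_deriv_ge(3)[of 0] edge assms(1) edge_le by (auto simp: m_def)
  have d: "0 \<le> d" "d \<le> edge" using assms e by (auto simp: d_def mult_left_le_one_le)
  have \<theta>: "m - d \<ge> 1" using m d e by simp
  define q where "q = a * sin d - 2 * u * (m - d)"
  \<comment> \<open>Three errors of order 1 / a: replacing sin d by d, replacing a * edge / 2 by m,
    and replacing m by m - d.\<close>
  have q_eq: "q = - (a * (d - sin d)) + u * (2 * (a * edge / 2 - m)) + 2 * (u * d)"
    by (simp add: q_def d_def algebra_simps)
  have "0 \<le> d - sin d" "d - sin d \<le> d\<^sup>2" using d e sin_x_le_x minus_sin_le_square by auto
  then have "0 \<le> a * (d - sin d)" "a * (d - sin d) \<le> a * d\<^sup>2" using a by auto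
  moreover have "a * d\<^sup>2 \<le> 4 * m\<^sup>2 / a"
  proof -
    have "a * d \<le> 2 * m" using order_trans[OF d(2) e(3)] a by (simp add: field_simps)
    from mult_mono[OF this this] have "a * d * (a * d) \<le> 2 * m * (2 * m)" using d a m by simp
    then show ?thesis using a by (simp add: field_simps power2_eq_square)
  qed
  moreover have "\<bar>u * (2 * (a * edge / 2 - m))\<bar> \<le> 1 * (2 * ((2 * m\<^sup>2 + 2 * m) / a))"
    unfolding abs_mult using edge_asymp assms by (intro mult_mono) (auto simp: m_def)
  moreover have "0 \<le> u * d" "u * d \<le> 1 * (2 * m / a)"
    using assms d e by (auto intro!: mult_nonneg_nonneg mult_mono[of u 1 d, simplified])
  ultimately have "\<bar>q\<bar> \<le> 4 * m\<^sup>2 / a + 2 * ((2 * m\<^sup>2 + 2 * m) / a) + 2 * (2 * m / a)"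
    unfolding q_eq by linarith
  also have "\<dots> = (8 * m\<^sup>2 + 8 * m) / a" by (simp add: add_divide_distrib)
  finally have q: "\<bar>q\<bar> \<le> (8 * m\<^sup>2 + 8 * m) / a" .
  have "(-1) ^ n * kp a (m - d) - (1 - 2 * u) = (cos d - 1) - q / (m - d)"
    unfolding m_def signed_kp using \<theta> by (simp add: q_def m_def diff_divide_distrib)
  moreover have "\<bar>cos d - 1\<bar> \<le> 2 * m / a"
  proof -
    have "d\<^sup>2 / 2 \<le> d" using d e mult_right_mono[of d 2 d] by (simp add: power2_eq_square)
    then show ?thesis unfolding abs_le_iff using one_minus_cos_le[of d] cos_le_one[of d] d e by linarith
  qed
  moreover have "\<bar>q / (m - d)\<bar> \<le> \<bar>q\<bar>"
    using \<theta> by (simp add: divide_le_eq mult_le_cancel_left1)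
  ultimately have "\<bar>(-1) ^ n * kp a (m - d) - (1 - 2 * u)\<bar> \<le> 2 * m / a + (8 * m\<^sup>2 + 8 * m) / a"
    using q by linarith
  also have "\<dots> = (8 * m\<^sup>2 + 10 * m) / a" by (simp add: add_divide_distrib)
  finally show ?thesis unfolding m_def d_def .
qed

end

section \<open>The bands\<close>

context
  fixes lo hi :: "nat \<Rightarrow> real"
  assumes lo_le_hi: "\<And>n. n \<ge> 1 \<Longrightarrow> lo n \<le> hi n"
    and hi_less_lo: "\<And>n. n \<ge> 1 \<Longrightarrow> hi n < lo (Suc n)"
begin

lemma hi_less_lo':
  assumes "1 \<le> m" "m < n"
  shows "hi m < lo n"
  using \<open>m < n\<close>
proof (induction n)
  case (Suc n)
  show ?case
  proof (cases "m = n")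
    case True
    then show ?thesis using hi_less_lo assms by simp
  next
    case False
    then have "hi m < lo n" "n \<ge> 1" using Suc assms by auto
    then show ?thesis using lo_le_hi[of n] hi_less_lo[of n] by linarith
  qed
qed simp

text \<open>A connected set reaching beyond the interval on either side contains a point of the
  adjacent gap, and that point lies in none of the intervals.\<close>

lemma separated_interval_maximal:
  assumes "n \<ge> 1" "connected D" "{lo n..hi n} \<subseteq> D" "D \<subseteq> (\<Union>m\<in>{1..}. {lo m..hi m})"
  shows "D = {lo n..hi n}"
proof (rule ccontr)
  assume "D \<noteq> {lo n..hi n}"
  with assms(3) obtain x where x: "x \<in> D" "x \<notin> {lo n..hi n}" by blast
  have nD: "lo n \<in> D" "hi n \<in> D" using assms(1,3) lo_le_hi by auto
  have interval: "z \<in> D" if "u \<in> D" "v \<in> D" "u \<le> z" "z \<le> v" for u v z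
    using assms(2) that unfolding connected_iff_interval by blast
  show False
  proof (cases "x > hi n")
    case True
    then obtain y where y: "hi n < y" "y < min x (lo (Suc n))"
      using dense[of "hi n" "min x (lo (Suc n))"] hi_less_lo[OF \<open>n \<ge> 1\<close>] by auto
    then have "y \<in> D" using interval[OF nD(2) x(1), of y] by simp
    then obtain m where m: "m \<ge> 1" "lo m \<le> y" "y \<le> hi m" using assms(4) by auto
    consider "m = n" | "m < n" | "m = Suc n" | "m > Suc n" by linarith
    then show False
    proof cases
      case 2
      then show False using hi_less_lo'[OF m(1), of n] lo_le_hi[OF \<open>n \<ge> 1\<close>] m y by linarith
    next
      case 4
      then show False using hi_less_lo'[of "Suc n" m] lo_le_hi[of "Suc n"] m y by simp
    qed (use m y in auto)
  next
    case False
    then have xn: "x < lo n" using x(2) by simp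
    obtain m where m: "m \<ge> 1" "lo m \<le> x" "x \<le> hi m" using x(1) assms(4) by auto
    have "m < n"
    proof (rule ccontr)
      assume "\<not> m < n"
      then show False
        using hi_less_lo'[OF \<open>n \<ge> 1\<close>, of m] lo_le_hi[OF \<open>n \<ge> 1\<close>] m xn
        by (cases "m = n") auto
    qed
    \<comment> \<open>On the left a neighbouring interval exists only because \<open>x\<close>
      itself lies in an earlier one.\<close>
    then obtain i where n: "n = Suc i" "i \<ge> 1" using m(1) by (cases n) auto
    have "hi m \<le> hi i"
      using hi_less_lo'[OF m(1), of i] lo_le_hi[OF n(2)] \<open>m < n\<close> n(1) by (cases "m = i") auto
    then obtain y where y: "hi i < y" "y < lo n"
      using dense[of "hi i" "lo n"] hi_less_lo[OF n(2)] n(1) by auto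
    then have "y \<in> D" using interval[OF x(1) nD(1), of y] m(3) \<open>hi m \<le> hi i\<close> by simp
    then obtain l where l: "l \<ge> 1" "lo l \<le> y" "y \<le> hi l" using assms(4) by auto
    consider "l = i" | "l < i" | "l = n" | "l > n" using n(1) by linarith
    then show False
    proof cases
      case 2
      then show False using hi_less_lo'[OF l(1), of i] lo_le_hi[OF n(2)] l y by linarith
    next
      case 4
      then show False using hi_less_lo'[of n l] lo_le_hi[of n] \<open>n \<ge> 1\<close> l y by simp
    qed (use l y in auto)
  qed
qed

lemma components_separated_intervals:
  "components (\<Union>m\<in>{1..}. {lo m..hi m}) = (\<lambda>n. {lo n..hi n}) ` {1..}"
proof -
  have mem: "{lo n..hi n} \<in> components (\<Union>m\<in>{1..}. {lo m..hi m})" if "n \<ge> 1" for n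
    unfolding in_components_maximal
    using that lo_le_hi[OF that] separated_interval_maximal[OF that] by auto
  show ?thesis
  proof (intro equalityI subsetI)
    fix C assume C: "C \<in> components (\<Union>m\<in>{1..}. {lo m..hi m})"
    then obtain x where "x \<in> C" using in_components_nonempty by blast
    moreover from this obtain n where n: "n \<ge> 1" "x \<in> {lo n..hi n}"
      using in_components_subset[OF C] by auto
    ultimately have "C = {lo n..hi n}" using components_eq[OF C mem[OF n(1)]] by blast
    with n(1) show "C \<in> (\<lambda>n. {lo n..hi n}) ` {1..}" by blast
  qed (use mem in auto)
qed

lemma components_below:
  assumes "n \<ge> 1"
  shows "{C \<in> components (\<Union>m\<in>{1..}. {lo m..hi m}). \<forall>x\<in>C. \<forall>y\<in>{lo n..hi n}. x < y}
    = (\<lambda>n. {lo n..hi n}) ` {1..<n}"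
proof -
  have "(\<forall>x\<in>{lo m..hi m}. \<forall>y\<in>{lo n..hi n}. x < y) \<longleftrightarrow> m < n" if "m \<ge> 1" for m
  proof
    assume *: "\<forall>x\<in>{lo m..hi m}. \<forall>y\<in>{lo n..hi n}. x < y"
    have "lo m \<in> {lo m..hi m}" "lo n \<in> {lo n..hi n}" using lo_le_hi that assms by auto
    with * have "lo m < lo n" by blast
    then show "m < n"
      using hi_less_lo'[OF assms, of m] lo_le_hi[OF assms]
      by (cases n m rule: linorder_cases) simp_all
  next
    assume "m < n"
    then show "\<forall>x\<in>{lo m..hi m}. \<forall>y\<in>{lo n..hi n}. x < y"
      using hi_less_lo'[OF that] by fastforce
  qed
  then have "{C \<in> (\<lambda>n. {lo n..hi n}) ` {1..}. \<forall>x\<in>C. \<forall>y\<in>{lo n..hi n}. x < y}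
    = (\<lambda>n. {lo n..hi n}) ` {m \<in> {1..}. m < n}"
    by blast
  moreover have "{m \<in> {1..}. m < n} = {1..<n}" by auto
  ultimately show ?thesis unfolding components_separated_intervals by simp
qed

lemma inj_on_separated_intervals: "inj_on (\<lambda>n. {lo n..hi n}) {1..}"
proof (rule inj_onI)
  fix m n :: nat
  assume mn: "m \<in> {1..}" "n \<in> {1..}" and eq: "{lo m..hi m} = {lo n..hi n}"
  have "lo m = lo n" using eq lo_le_hi[of m] lo_le_hi[of n] mn by (simp add: Icc_eq_Icc)
  then show "m = n"
    using hi_less_lo'[of m n] hi_less_lo'[of n m] lo_le_hi[of m] lo_le_hi[of n] mn
    by (cases m n rule: linorder_cases) auto
qed

text \<open>The description in \<open>band\<close> is stated verbatim, so that the lemma applies as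
  soon as \<open>band\<close> is unfolded. The intervals are distinct, so the number of components
  below identifies the index.\<close>

lemma nth_component_separated_intervals:
  assumes "n \<ge> 1" and S: "S = (\<Union>m\<in>{1..}. {lo m..hi m})"
  shows "(THE B. B \<in> components S \<and>
        finite {C \<in> components S. \<forall>x\<in>C. \<forall>y\<in>B. x < y} \<and>
        card {C \<in> components S. \<forall>x\<in>C. \<forall>y\<in>B. x < y} = n - 1) = {lo n..hi n}"
proof (rule the_equality)
  have card: "card ((\<lambda>n. {lo n..hi n}) ` {1..<m}) = m - 1" for m
    by (subst card_image) (auto intro: inj_on_subset[OF inj_on_separated_intervals])
  show "{lo n..hi n} \<in> components S \<and>
        finite {C \<in> components S. \<forall>x\<in>C. \<forall>y\<in>{lo n..hi n}. x < y} \<and>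
        card {C \<in> components S. \<forall>x\<in>C. \<forall>y\<in>{lo n..hi n}. x < y} = n - 1"
    unfolding S components_below[OF assms(1)] card
    unfolding components_separated_intervals using assms(1) by blast
  fix B
  assume B: "B \<in> components S \<and>
        finite {C \<in> components S. \<forall>x\<in>C. \<forall>y\<in>B. x < y} \<and>
        card {C \<in> components S. \<forall>x\<in>C. \<forall>y\<in>B. x < y} = n - 1"
  then obtain m where m: "m \<ge> 1" "B = {lo m..hi m}"
    unfolding S components_separated_intervals by auto
  have "m - 1 = n - 1" using B unfolding m(2) S components_below[OF m(1)] card by simp
  then have "m = n" using m(1) assms(1) by simp
  then show "B = {lo n..hi n}" by (simp add: m(2))
qed

end

section \<open>The bands of the periodic operator\<close>

lemma band_set_eq:
  assumes "L > 0" "A > 0"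
  shows "band_set A L =
    (\<Union>n\<in>{1..}. {(real n * pi - edge n (A * L / 2)) / L..real n * pi / L})" (is "_ = (\<Union>n\<in>_. ?I n)")
proof -
  define a where "a = A * L / 2"
  have a: "a > 0" using assms by (simp add: a_def)
  show ?thesis unfolding a_def[symmetric]
  proof (intro equalityI subsetI)
    fix \<omega> assume \<omega>: "\<omega> \<in> band_set A L"
    have "\<omega> \<noteq> 0"
    proof
      assume "\<omega> = 0"
      then have "cmod (1 + of_real a) \<le> 1" using \<omega> half_trace_0[OF assms(1), of A]
        by (simp add: band_set_def a_def)
      moreover have "cmod (1 + of_real a) = \<bar>1 + a\<bar>" by (metis norm_of_real of_real_1 of_real_add)
      ultimately show False using a by simp
    qed
    with \<omega> have pos: "\<omega> > 0" by (simp add: band_set_def)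
    with \<omega> have le: "\<bar>kp a (\<omega> * L)\<bar> \<le> 1"
      using half_trace_kp[OF assms(1), of \<omega> A] by (simp add: band_set_def a_def)
    \<comment> \<open>Rounding \<theta> / pi up writes each positive \<theta> uniquely as n pi - d
      with 0 \<le> d < pi.\<close>
    define n where "n = nat \<lceil>\<omega> * L / pi\<rceil>"
    define d where "d = real n * pi - \<omega> * L"
    have x: "\<omega> * L / pi > 0" using pos assms by simp
    have c: "\<lceil>\<omega> * L / pi\<rceil> \<ge> 1" using x by simp
    have n: "n \<ge> 1" "real n = of_int \<lceil>\<omega> * L / pi\<rceil>"
      unfolding n_def using c by (linarith, intro of_nat_nat) linarith
    have "\<omega> * L / pi \<le> real n" "real n < \<omega> * L / pi + 1" unfolding n(2) by linarith+
    then have d: "0 \<le> d" "d < pi" by (auto simp: d_def field_simps)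
    have "\<omega> * L = real n * pi - d" by (simp add: d_def)
    then have "d \<le> edge n a" using abs_kp_le_1_iff[OF n(1) a d] le by simp
    then have "\<omega> \<in> {(real n * pi - edge n a) / L..real n * pi / L}"
      using d assms by (simp add: d_def field_simps)
    with n(1) show "\<omega> \<in> (\<Union>n\<in>{1..}. {(real n * pi - edge n a) / L..real n * pi / L})" by auto
  next
    fix \<omega> assume "\<omega> \<in> (\<Union>n\<in>{1..}. {(real n * pi - edge n a) / L..real n * pi / L})"
    then obtain n where n: "n \<ge> 1"
      and "(real n * pi - edge n a) / L \<le> \<omega>" "\<omega> \<le> real n * pi / L" by auto
    then have \<omega>: "real n * pi - edge n a \<le> \<omega> * L" "\<omega> * L \<le> real n * pi"
      using assms by (auto simp: field_simps)
    define d where "d = real n * pi - \<omega> * L"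
    have d: "0 \<le> d" "d \<le> edge n a" "d < pi" using \<omega> edge[OF n a] by (auto simp: d_def)
    have "real n * pi - d > 0" using below_npi_pos[OF n a d(3)] .
    then have "\<omega> > 0" using assms by (simp add: d_def zero_less_mult_iff)
    moreover have "\<bar>kp a (\<omega> * L)\<bar> \<le> 1" using abs_kp_le_1_iff[OF n a d(1,3)] d(2) by (simp add: d_def)
    ultimately show "\<omega> \<in> band_set A L"
      using half_trace_kp[OF assms(1), of \<omega> A] by (simp add: band_set_def a_def)
  qed
qed

lemma band_eq:
  assumes "L > 0" "A > 0" "n \<ge> 1"
  shows "band A L n = {(real n * pi - edge n (A * L / 2)) / L..real n * pi / L}"
  unfolding band_def
proof (rule nth_component_separated_intervals)
  have a: "A * L / 2 > 0" using assms by simp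
  show "(real m * pi - edge m (A * L / 2)) / L \<le> real m * pi / L" if "m \<ge> 1" for m
    using edge(1)[OF that a] assms(1) by (simp add: divide_right_mono)
  show "real m * pi / L < (real (Suc m) * pi - edge (Suc m) (A * L / 2)) / L" if "m \<ge> 1" for m
    using edge(2)[of "Suc m", OF _ a] assms(1)
    by (intro divide_strict_right_mono) (auto simp: algebra_simps)
qed (use assms band_set_eq[OF assms(1,2)] in simp_all)

section \<open>The dispersion relation on a band\<close>

lemma at_within_upper_half_plane_neq_bot: "at (complex_of_real x) within {z. Im z > 0} \<noteq> bot"
  unfolding trivial_limit_within islimpt_approachable
proof (intro notI, elim notE, intro allI impI)
  fix e :: real assume "e > 0"
  then show "\<exists>z\<in>{z. Im z > 0}. z \<noteq> complex_of_real x \<and> dist z (complex_of_real x) < e"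
    by (intro bexI[of _ "Complex x (e / 2)"]) (auto simp: dist_norm complex_eq_iff cmod_def)
qed

context
  fixes A L :: real and k :: "complex \<Rightarrow> complex"
  assumes dr: "dispersion_relation A L k" and L: "L > 0"
begin

text \<open>The identity holds in the open half plane and both sides have limits at real points, so
  it extends to the boundary.\<close>

lemma cos_dispersion:
  assumes "\<omega> > 0"
  shows "cos (k (complex_of_real \<omega>)) = of_real (kp (A * L / 2) (\<omega> * L))"
proof -
  let ?F = "at (complex_of_real \<omega>) within {z. Im z > 0}"
  have "(k \<longlongrightarrow> k (complex_of_real \<omega>)) ?F"
    using dr assms unfolding dispersion_relation_def by auto
  then have 1: "((\<lambda>z. cos (k z)) \<longlongrightarrow> cos (k (complex_of_real \<omega>))) ?F"
    by (rule tendsto_cos)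
  have "((\<lambda>z. cos (z * L) + of_real A / (2 * z) * sin (z * L)) \<longlongrightarrow>
      cos (of_real \<omega> * complex_of_real L) + of_real A / (2 * of_real \<omega>) * sin (of_real \<omega> * complex_of_real L)) ?F"
    by (intro tendsto_intros) (use assms in auto)
  also have "cos (of_real \<omega> * complex_of_real L) + of_real A / (2 * of_real \<omega>) * sin (of_real \<omega> * complex_of_real L)
     = half_trace A L (of_real \<omega>)"
    using half_trace_eq[OF L, of "of_real \<omega>" A] assms by simp
  finally have "((\<lambda>z. cos (k z)) \<longlongrightarrow> half_trace A L (of_real \<omega>)) ?F"
  proof (rule Lim_transform_within[of _ _ _ _ 1])
    fix z assume "z \<in> {z. Im z > 0}"
    then have "z \<noteq> 0" "cos (k z) = half_trace A L z"
      using dr unfolding dispersion_relation_def by auto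
    then show "cos (z * L) + of_real A / (2 * z) * sin (z * L) = cos (k z)"
      using half_trace_eq[OF L, of z A] by simp
  qed auto
  with 1 have "cos (k (complex_of_real \<omega>)) = half_trace A L (of_real \<omega>)"
    using tendsto_unique[OF at_within_upper_half_plane_neq_bot] by blast
  then show ?thesis using half_trace_kp[OF L assms, of A] by simp
qed

text \<open>Continuity along the real axis is inherited from that up to the boundary of the half plane.\<close>

lemma isCont_dispersion:
  assumes "\<omega> > 0"
  shows "isCont (\<lambda>x. k (complex_of_real x)) \<omega>"
  unfolding continuous_at_eps_delta
proof (intro allI impI)
  fix e :: real assume "e > 0"
  let ?S = "{z. Im z > 0}"
  have lim: "(k \<longlongrightarrow> k (complex_of_real x)) (at (complex_of_real x) within ?S)" if "x > 0" for x
    using dr that unfolding dispersion_relation_def by auto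
  have "\<forall>\<^sub>F z in at (complex_of_real \<omega>) within ?S. dist (k z) (k (complex_of_real \<omega>)) < e / 2"
    using lim[OF assms] \<open>e > 0\<close> tendstoD half_gt_zero by blast
  then obtain d where d: "d > 0"
    "\<And>z. z \<in> ?S \<Longrightarrow> z \<noteq> complex_of_real \<omega> \<Longrightarrow> dist z (complex_of_real \<omega>) < d \<Longrightarrow> dist (k z) (k (complex_of_real \<omega>)) < e / 2"
    unfolding eventually_at by blast
  show "\<exists>d>0. \<forall>x. dist x \<omega> < d \<longrightarrow> dist (k (complex_of_real x)) (k (complex_of_real \<omega>)) < e"
  \<comment> \<open>The minimum keeps \<open>x\<close> positive, where boundary limits are
    available. Passing to the limit in \<open>z\<close> loses strictness, hence the earlier e /
    2.\<close>
  proof (intro exI[of _ "min d \<omega>"] conjI allI impI)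
    fix x assume x: "dist x \<omega> < min d \<omega>"
    then have "x > 0" by (auto simp: dist_real_def abs_if split: if_splits)
    let ?F = "at (complex_of_real x) within ?S"
    have "complex_of_real x \<in> ball (complex_of_real \<omega>) d"
      using x by (simp add: dist_commute)
    then have "\<forall>\<^sub>F z in ?F. z \<in> ball (complex_of_real \<omega>) d"
      by (intro eventually_at_topological[THEN iffD2]) (use open_ball in blast)
    moreover have "\<forall>\<^sub>F z in ?F. z \<in> ?S"
      by (simp add: eventually_at_filter)
    ultimately have "\<forall>\<^sub>F z in ?F. dist (k z) (k (complex_of_real \<omega>)) \<le> e / 2"
    proof eventually_elim
      case (elim z)
      then have "z \<noteq> complex_of_real \<omega>" by auto
      with elim show ?case using d(2)[of z] by (simp add: dist_commute)
    qed
    moreover have "((\<lambda>z. dist (k z) (k (complex_of_real \<omega>))) \<longlongrightarrow> dist (k (complex_of_real x)) (k (complex_of_real \<omega>))) ?F"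
      by (intro tendsto_dist lim \<open>x > 0\<close> tendsto_const)
    ultimately have "dist (k (complex_of_real x)) (k (complex_of_real \<omega>)) \<le> e / 2"
      using tendsto_upperbound at_within_upper_half_plane_neq_bot by blast
    then show "dist (k (complex_of_real x)) (k (complex_of_real \<omega>)) < e"
      using \<open>e > 0\<close> by simp
  qed (use d assms in auto)
qed

text \<open>Only continuity of \<open>k\<close> along the axis is available. Caratheodory's form of
  the derivative of cos writes the increment of F as \<open>g (\<kappa> x)\<close> times the
  increment of \<open>\<kappa>\<close>; continuity makes this factor tend to -sin \<kappa>, which is
  nonzero, and division gives the derivative of \<open>\<kappa>\<close>.\<close>

lemma has_vector_derivative_dispersion:
  assumes "\<omega> > 0" "sin (k (complex_of_real \<omega>)) \<noteq> 0"
  shows "((\<lambda>x. k (complex_of_real x)) has_vector_derivative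
      of_real (L * kp_deriv (A * L / 2) (\<omega> * L)) / - sin (k (complex_of_real \<omega>))) (at \<omega>)"
proof -
  define \<kappa> where "\<kappa> x = k (complex_of_real x)" for x
  define f where "f x = kp (A * L / 2) (x * L)" for x
  define f' where "f' = L * kp_deriv (A * L / 2) (\<omega> * L)"
  have s: "sin (\<kappa> \<omega>) \<noteq> 0" using assms by (simp add: \<kappa>_def)
  have c: "cos (\<kappa> x) = of_real (f x)" if "x > 0" for x
    using cos_dispersion[OF that] by (simp add: \<kappa>_def f_def)
  obtain g where g: "\<And>z. cos z - cos (\<kappa> \<omega>) = g z * (z - \<kappa> \<omega>)" "isCont g (\<kappa> \<omega>)" "g (\<kappa> \<omega>) = - sin (\<kappa> \<omega>)"
    using DERIV_cos[of "\<kappa> \<omega>"] unfolding CARAT_DERIV by blast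
  have cont: "isCont \<kappa> \<omega>" unfolding \<kappa>_def[abs_def] by (rule isCont_dispersion[OF assms(1)])
  have glim: "((\<lambda>x. g (\<kappa> x)) \<longlongrightarrow> - sin (\<kappa> \<omega>)) (at \<omega>)"
    using isCont_o2[OF cont g(2)] g(3) by (simp add: isCont_def)
  have "(f has_real_derivative f') (at \<omega>)"
  proof -
    have "(kp (A * L / 2) has_real_derivative kp_deriv (A * L / 2) (\<omega> * L)) (at (\<omega> * L))"
      using assms L by (intro has_real_derivative_kp) simp
    moreover have "((\<lambda>x. x * L) has_real_derivative L) (at \<omega>)"
      by (auto intro!: derivative_eq_intros)
    ultimately have "((\<lambda>x. kp (A * L / 2) (x * L)) has_real_derivative
        kp_deriv (A * L / 2) (\<omega> * L) * L) (at \<omega>)"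
      by (rule DERIV_chain2[where f = "kp (A * L / 2)" and g = "\<lambda>x. x * L"])
    then show ?thesis unfolding f_def[abs_def] f'_def by (simp only: mult.commute[of L])
  qed
  then have "((\<lambda>x. (f x - f \<omega>) / (x - \<omega>)) \<longlongrightarrow> f') (at \<omega>)"
    by (simp add: has_field_derivative_iff)
  then have "((\<lambda>x. complex_of_real ((f x - f \<omega>) / (x - \<omega>)) / g (\<kappa> x)) \<longlongrightarrow> of_real f' / - sin (\<kappa> \<omega>)) (at \<omega>)"
    by (intro tendsto_divide tendsto_of_real glim) (use s in auto)
  moreover have "\<forall>\<^sub>F x in at \<omega>. complex_of_real ((f x - f \<omega>) / (x - \<omega>)) / g (\<kappa> x) = (\<kappa> x - \<kappa> \<omega>) / of_real (x - \<omega>)"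
  proof -
    have "\<forall>\<^sub>F x in at \<omega>. g (\<kappa> x) \<noteq> 0" by (rule tendsto_imp_eventually_ne[OF glim]) (use s in simp)
    moreover have "\<forall>\<^sub>F x in at \<omega>. x > 0"
      using order_tendstoD(1)[OF tendsto_ident_at assms(1)] .
    moreover have "\<forall>\<^sub>F x in at \<omega>. x \<noteq> \<omega>" by (simp add: eventually_at_filter)
    ultimately show ?thesis
    proof eventually_elim
      case (elim x)
      have eq: "complex_of_real (f x - f \<omega>) = g (\<kappa> x) * (\<kappa> x - \<kappa> \<omega>)"
        using g(1)[of "\<kappa> x"] c[OF elim(2)] c[OF assms(1)] by simp
      show ?case unfolding of_real_divide eq using elim by simp
    qed
  qed
  ultimately have "((\<lambda>x. (\<kappa> x - \<kappa> \<omega>) / of_real (x - \<omega>)) \<longlongrightarrow> of_real f' / - sin (\<kappa> \<omega>)) (at \<omega>)"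
    by (rule Lim_transform_eventually)
  then have "((\<lambda>x. norm ((\<kappa> x - \<kappa> \<omega>) / of_real (x - \<omega>) - of_real f' / - sin (\<kappa> \<omega>))) \<longlongrightarrow> 0) (at \<omega>)"
    by (intro tendsto_norm_zero LIM_zero)
  then have "((\<lambda>x. norm (\<kappa> x - \<kappa> \<omega> - (x - \<omega>) *\<^sub>R (of_real f' / - sin (\<kappa> \<omega>))) / norm (x - \<omega>)) \<longlongrightarrow> 0) (at \<omega>)"
  proof (rule Lim_transform_eventually)
    have "\<forall>\<^sub>F x in at \<omega>. x \<noteq> \<omega>" by (simp add: eventually_at_filter)
    then show "\<forall>\<^sub>F x in at \<omega>. norm ((\<kappa> x - \<kappa> \<omega>) / of_real (x - \<omega>) - of_real f' / - sin (\<kappa> \<omega>))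
      = norm (\<kappa> x - \<kappa> \<omega> - (x - \<omega>) *\<^sub>R (of_real f' / - sin (\<kappa> \<omega>))) / norm (x - \<omega>)"
    proof eventually_elim
      case (elim x)
      define D where "D = of_real f' / - sin (\<kappa> \<omega>)"
      have "(\<kappa> x - \<kappa> \<omega>) / of_real (x - \<omega>) - D = (\<kappa> x - \<kappa> \<omega> - (x - \<omega>) *\<^sub>R D) / of_real (x - \<omega>)"
        using elim by (simp add: scaleR_conv_of_real diff_divide_distrib)
      then show ?case unfolding D_def[symmetric] by (simp only: norm_divide norm_of_real real_norm_def)
    qed
  qed
  then have "(\<kappa> has_vector_derivative of_real f' / - sin (\<kappa> \<omega>)) (at \<omega>)"
    unfolding has_vector_derivative_def has_derivative_iff_norm
    by (intro conjI bounded_linear_scaleR_left)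
  then show ?thesis by (simp add: \<kappa>_def[abs_def] f'_def)
qed

end

lemma cmod_sin_of_cos:
  assumes "cos z = complex_of_real y" "\<bar>y\<bar> \<le> 1"
  shows "cmod (sin z) = sqrt (1 - y\<^sup>2)"
proof -
  have "(sin z)\<^sup>2 = of_real (1 - y\<^sup>2)" using sin_squared_eq[of z] assms(1) by simp
  then have "(cmod (sin z))\<^sup>2 = \<bar>1 - y\<^sup>2\<bar>" by (metis norm_of_real norm_power)
  moreover have "y\<^sup>2 \<le> 1" using assms(2) by (simp add: abs_square_le_1)
  ultimately show ?thesis by (simp add: real_sqrt_unique)
qed

lemma norm_inverse_sqrt_le:
  fixes x :: real
  assumes "x \<noteq> 0"
  shows "1 / sqrt (1 + x\<^sup>2) \<le> 1 / \<bar>x\<bar>"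
proof -
  have "\<bar>x\<bar> = sqrt (x\<^sup>2)" by simp
  also have "\<dots> \<le> sqrt (1 + x\<^sup>2)" by (intro real_sqrt_le_mono) simp
  finally show ?thesis using assms by (intro divide_left_mono) (auto intro!: mult_pos_pos add_pos_nonneg)
qed

section \<open>Transmission and group velocity on a band at fixed coupling\<close>

context
  fixes A L :: real and k :: "complex \<Rightarrow> complex" and n :: nat
  assumes dr: "dispersion_relation A L k" and L: "L > 0" and A: "A > 0" and n: "n \<ge> 1"
begin

private abbreviation (input) "a \<equiv> A * L / 2"
private abbreviation (input) "B \<equiv> band A L n"
private abbreviation (input) "F \<omega> \<equiv> kp (A * L / 2) (\<omega> * L)"

lemma a_pos: "a > 0" using A L by simp

lemma band_iff: "\<omega> \<in> B \<longleftrightarrow> \<omega> * L \<in> {real n * pi - edge n a..real n * pi}"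
  unfolding band_eq[OF L A n] using L by (auto simp: field_simps)

lemma band_pos: "\<omega> \<in> B \<Longrightarrow> \<omega> > 0"
proof -
  assume "\<omega> \<in> B"
  then have "\<omega> * L > 0"
    using below_npi_pos[OF n a_pos edge(2)[OF n a_pos]] unfolding band_iff by simp
  then show "\<omega> > 0" using L by (simp add: zero_less_mult_iff)
qed

lemma band_le: "\<omega> \<in> B \<Longrightarrow> \<omega> \<le> real n * pi / L"
  unfolding band_eq[OF L A n] by simp

lemma bij_betw_half_trace: "bij_betw (\<lambda>\<omega>. F \<omega>) B {-1..1}"
proof -
  have "bij_betw (\<lambda>\<omega>. \<omega> * L) B {real n * pi - edge n a..real n * pi}"
    by (rule bij_betwI[of _ _ _ "\<lambda>\<theta>. \<theta> / L"]) (use L band_iff in \<open>auto simp: Pi_def\<close>)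
  from bij_betw_trans[OF this bij_betw_kp[OF n a_pos]] show ?thesis by (simp add: o_def)
qed

lemma abs_half_trace_le: "\<omega> \<in> B \<Longrightarrow> \<bar>F \<omega>\<bar> \<le> 1"
  using bij_betw_apply[OF bij_betw_half_trace, of \<omega>] by (auto simp: abs_le_iff)

lemma sin_ratio_dispersion:
  "\<omega> \<in> B \<Longrightarrow> sin_ratio N (k (complex_of_real \<omega>)) = of_real (cheb_U N (F \<omega>))"
  unfolding sin_ratio_eq of_real_cheb_U using cos_dispersion[OF dr L band_pos] by simp

lemma cmod_transmission_band:
  assumes "\<omega> \<in> B" "N \<ge> 1"
  shows "cmod (transmission A L N \<omega>) = 1 / sqrt (1 + (A / (2 * \<omega>) * cheb_U N (F \<omega>))\<^sup>2)"
  using cmod_transmission[OF L _ assms(2), of \<omega> A] band_pos[OF assms(1)] L by (simp add: kp_def)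

lemma cmod_transmission_le:
  assumes "\<omega> \<in> B" "N \<ge> 1" "0 < u" "u \<le> \<bar>cheb_U N (F \<omega>)\<bar>"
  shows "cmod (transmission A L N \<omega>) \<le> 2 * (real n * pi / L) / (A * u)"
proof -
  let ?U = "cheb_U N (F \<omega>)"
  have \<omega>: "\<omega> > 0" "\<omega> \<le> real n * pi / L" using assms band_pos band_le by auto
  have U: "\<bar>?U\<bar> > 0" using assms by linarith
  have "cmod (transmission A L N \<omega>) \<le> 1 / \<bar>A / (2 * \<omega>) * ?U\<bar>"
    unfolding cmod_transmission_band[OF assms(1,2)]
    using U \<omega> A by (intro norm_inverse_sqrt_le) auto
  also have "\<dots> = 2 * \<omega> / (A * \<bar>?U\<bar>)" using \<omega> A by (simp add: abs_mult)
  also have "\<dots> \<le> 2 * (real n * pi / L) / (A * u)"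
    using assms \<omega> A U by (intro frac_le mult_left_mono mult_pos_pos) auto
  finally show ?thesis .
qed

text \<open>sin Nk factors as U_N(F) sin k. A root of U_N cannot occur where sin k = 0, because F
  would be 1 or -1 there.\<close>

lemma transparency_points_eq:
  assumes "N \<ge> 1"
  shows "transparency_points k B N = {\<omega> \<in> B. cheb_U N (F \<omega>) = 0}"
proof -
  have "sin (of_nat N * k (complex_of_real \<omega>)) = 0 \<and> sin (k (complex_of_real \<omega>)) \<noteq> 0
    \<longleftrightarrow> cheb_U N (F \<omega>) = 0" if "\<omega> \<in> B" for \<omega>
  proof -
    have c: "cos (k (complex_of_real \<omega>)) = of_real (F \<omega>)" using cos_dispersion[OF dr L band_pos[OF that]] .
    have "sin (k (complex_of_real \<omega>)) \<noteq> 0" if "cheb_U N (F \<omega>) = 0"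
    proof
      assume "sin (k (complex_of_real \<omega>)) = 0"
      then have "(cos (k (complex_of_real \<omega>)))\<^sup>2 = 1" by (simp add: cos_squared_eq)
      then have "complex_of_real ((F \<omega>)\<^sup>2) = of_real 1" unfolding c by simp
      then have "(F \<omega>)\<^sup>2 = 1" unfolding of_real_eq_iff .
      with that cheb_U_pm1_neq_0[OF assms] show False by blast
    qed
    moreover have "sin (of_nat N * k (complex_of_real \<omega>)) = of_real (cheb_U N (F \<omega>)) * sin (k (complex_of_real \<omega>))"
      unfolding of_real_cheb_U c[symmetric] cheb_U_cos ..
    ultimately show ?thesis by auto
  qed
  then show ?thesis unfolding transparency_points_def by blast
qed

lemma card_transparency_points:
  assumes "N \<ge> 1"
  shows "finite (transparency_points k B N)" "card (transparency_points k B N) = N - 1"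
proof -
  have inj: "inj_on (\<lambda>\<omega>. F \<omega>) (transparency_points k B N)"
    by (rule inj_on_subset[OF bij_betw_imp_inj_on[OF bij_betw_half_trace]])
       (auto simp: transparency_points_eq[OF assms])
  have im: "(\<lambda>\<omega>. F \<omega>) ` transparency_points k B N = {y::real. -1 \<le> y \<and> y \<le> 1 \<and> cheb_U N y = 0}"
  proof (intro equalityI subsetI)
    fix y assume "y \<in> {y::real. -1 \<le> y \<and> y \<le> 1 \<and> cheb_U N y = 0}"
    moreover from this obtain \<omega> where "\<omega> \<in> B" "F \<omega> = y"
      using bij_betw_imp_surj_on[OF bij_betw_half_trace] by (metis (no_types, lifting) atLeastAtMost_iff imageE mem_Collect_eq)
    ultimately show "y \<in> (\<lambda>\<omega>. F \<omega>) ` transparency_points k B N"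
      unfolding transparency_points_eq[OF assms] by blast
  next
    fix y assume "y \<in> (\<lambda>\<omega>. F \<omega>) ` transparency_points k B N"
    then show "y \<in> {y::real. -1 \<le> y \<and> y \<le> 1 \<and> cheb_U N y = 0}"
      using abs_half_trace_le unfolding transparency_points_eq[OF assms] by (fastforce simp: abs_le_iff)
  qed
  show "finite (transparency_points k B N)"
    using card_cheb_U_roots(1)[OF assms] unfolding im[symmetric] by (rule finite_imageD[OF _ inj])
  show "card (transparency_points k B N) = N - 1"
    using card_cheb_U_roots(2)[OF assms] card_image[OF inj] unfolding im by simp
qed

lemma transparency_point_exists:
  fixes y :: real
  assumes "N \<ge> 1" "-1 \<le> y" "y \<le> 1" "cheb_U N y = 0"
  obtains p where "p \<in> transparency_points k B N" "F p = y"
proof -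
  have "y \<in> (\<lambda>\<omega>. F \<omega>) ` B" using bij_betw_imp_surj_on[OF bij_betw_half_trace] assms by simp
  then show thesis using that assms unfolding transparency_points_eq[OF assms(1)] by blast
qed

lemma half_trace_expanding:
  assumes "a \<ge> 2 * real n * pi" "\<omega> \<in> B" "\<omega>' \<in> B"
  shows "A * L\<^sup>2 / (4 * real n * pi) * \<bar>\<omega> - \<omega>'\<bar> \<le> \<bar>F \<omega> - F \<omega>'\<bar>"
proof -
  have "a / (2 * real n * pi) * \<bar>\<omega> * L - \<omega>' * L\<bar> \<le> \<bar>F \<omega> - F \<omega>'\<bar>"
    using assms by (intro kp_expanding[OF n a_pos]) (auto simp: band_iff)
  moreover have "\<bar>\<omega> * L - \<omega>' * L\<bar> = \<bar>\<omega> - \<omega>'\<bar> * L"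
    using L by (simp add: abs_mult flip: left_diff_distrib)
  ultimately show ?thesis by (simp add: power2_eq_square mult_ac)
qed

lemma interior_band:
  "interior B = {(real n * pi - edge n a) / L<..<real n * pi / L}"
  unfolding band_eq[OF L A n] by (rule interior_atLeastAtMost_real)

lemma sin_dispersion_neq_0:
  assumes "\<omega> \<in> interior B"
  shows "sin (k (complex_of_real \<omega>)) \<noteq> 0"
proof
  assume "sin (k (complex_of_real \<omega>)) = 0"
  have th: "real n * pi - edge n a < \<omega> * L" "\<omega> * L < real n * pi"
    using assms L unfolding interior_band by (auto simp: field_simps)
  have B: "\<omega> \<in> B" using assms interior_subset by blast
  have "1 - (F \<omega>)\<^sup>2 = 0"
    using cmod_sin_of_cos[OF cos_dispersion[OF dr L band_pos[OF B]] abs_half_trace_le[OF B]]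
      \<open>sin (k (complex_of_real \<omega>)) = 0\<close> by simp
  then have "((-1) ^ n * F \<omega>)\<^sup>2 = 1" by (simp add: power_mult_distrib flip: power_mult)
  then have "(-1) ^ n * F \<omega> = 1 \<or> (-1) ^ n * F \<omega> = -1" by (rule power2_eq_1_iff[THEN iffD1])
  moreover have "(-1) ^ n * F \<omega> < 1"
    using signed_kp_strict_mono[OF n a_pos _ th(2)] signed_kp_npi[OF n a_pos] th by simp
  moreover have "-1 < (-1) ^ n * F \<omega>"
    using signed_kp_strict_mono[OF n a_pos order_refl th(1)] signed_kp_edge[OF n a_pos] th by simp
  ultimately show False by linarith
qed

lemma dispersion_differentiable:
  assumes "\<omega> \<in> interior B"
  shows "(\<lambda>x. k (complex_of_real x)) differentiable (at \<omega>)"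
    and "dispersion_deriv k \<omega> = of_real (L * kp_deriv a (\<omega> * L)) / - sin (k (complex_of_real \<omega>))"
    and "kp_deriv a (\<omega> * L) \<noteq> 0"
proof -
  have B: "\<omega> \<in> B" using assms interior_subset by blast
  note d = has_vector_derivative_dispersion[OF dr L band_pos[OF B] sin_dispersion_neq_0[OF assms]]
  show "(\<lambda>x. k (complex_of_real x)) differentiable (at \<omega>)"
    using d by (rule differentiableI_vector)
  show "dispersion_deriv k \<omega> = of_real (L * kp_deriv a (\<omega> * L)) / - sin (k (complex_of_real \<omega>))"
    unfolding dispersion_deriv_def using d by (rule vector_derivative_at)
  show "kp_deriv a (\<omega> * L) \<noteq> 0"
    using signed_kp_deriv_pos[OF n a_pos, of "real n * pi - \<omega> * L"] B unfolding band_iff by auto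
qed

text \<open>The factor sqrt (1 - F^2), which is |sin k|, is retained because it forces the value 0
  at the band edges.\<close>

lemma inverse_dispersion_deriv_le:
  assumes "a \<ge> 2 * real n * pi" "\<omega> \<in> interior B"
  shows "cmod (complex_of_real L / dispersion_deriv k \<omega>)
     \<le> sqrt (1 - (F \<omega>)\<^sup>2) * (real n * pi / (a * cos (edge n a)))"
proof -
  have B: "\<omega> \<in> B" using assms interior_subset by blast
  note D = dispersion_differentiable[OF assms(2)]
  have "complex_of_real L / dispersion_deriv k \<omega>
      = - sin (k (complex_of_real \<omega>)) / of_real (kp_deriv a (\<omega> * L))"
    unfolding D(2) using L by simp
  then have "cmod (complex_of_real L / dispersion_deriv k \<omega>)
      = sqrt (1 - (F \<omega>)\<^sup>2) / \<bar>kp_deriv a (\<omega> * L)\<bar>"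
    using cmod_sin_of_cos[OF cos_dispersion[OF dr L band_pos[OF B]] abs_half_trace_le[OF B]]
    by (simp add: norm_divide)
  also have "\<dots> \<le> sqrt (1 - (F \<omega>)\<^sup>2) / (a / (real n * pi) * cos (edge n a))"
  proof (rule divide_left_mono)
    have "a / (real n * pi) * cos (edge n a) \<le> (-1) ^ n * kp_deriv a (\<omega> * L)"
      using kp_deriv_ge(1)[OF n a_pos, of "real n * pi - \<omega> * L"] B assms(1) unfolding band_iff by simp
    also have "\<dots> \<le> \<bar>(-1) ^ n * kp_deriv a (\<omega> * L)\<bar>" by simp
    also have "\<dots> = \<bar>kp_deriv a (\<omega> * L)\<bar>" by (simp add: abs_mult)
    finally show "a / (real n * pi) * cos (edge n a) \<le> \<bar>kp_deriv a (\<omega> * L)\<bar>" .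
    have "cos (edge n a) > 0"
      using kp_deriv_ge(2)[OF n a_pos order_refl less_imp_le[OF edge(1)[OF n a_pos]] assms(1)] by linarith
    then have c: "a / (real n * pi) * cos (edge n a) > 0" using a_pos n by simp
    show "0 < \<bar>kp_deriv a (\<omega> * L)\<bar> * (a / (real n * pi) * cos (edge n a))"
      by (rule mult_pos_pos[OF _ c]) (simp add: D(3))
    show "0 \<le> sqrt (1 - (F \<omega>)\<^sup>2)"
      using abs_half_trace_le[OF B] by (simp add: abs_square_le_1)
  qed
  finally show ?thesis by (simp add: mult_ac)
qed

lemma group_velocity_le:
  assumes "a \<ge> 2 * real n * pi" "\<omega> \<in> B"
  shows "cmod (group_velocity L k B \<omega>) \<le> real n * pi / (a * cos (edge n a))"
proof -
  define c where "c = real n * pi / (a * cos (edge n a))"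
  have "cos (edge n a) > 0"
    using kp_deriv_ge(2)[OF n a_pos order_refl less_imp_le[OF edge(1)[OF n a_pos]] assms(1)] by linarith
  then have c: "c \<ge> 0" unfolding c_def using a_pos by simp
  note le = inverse_dispersion_deriv_le[OF assms(1), folded c_def]
  show ?thesis unfolding c_def[symmetric]
  proof (cases "\<omega> \<in> interior B")
    case True
    have "sqrt (1 - (F \<omega>)\<^sup>2) * c \<le> 1 * c" using c by (intro mult_right_mono) auto
    with le[OF True] True show "cmod (group_velocity L k B \<omega>) \<le> c"
      by (simp add: group_velocity_def)
  next
    case False
    have int: "interior B = {(real n * pi - edge n a) / L<..<real n * pi / L}" by (rule interior_band)
    have ne: "(real n * pi - edge n a) / L < real n * pi / L"
      using edge(1)[OF n a_pos] L by (simp add: divide_strict_right_mono)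
    have \<omega>: "\<omega> = (real n * pi - edge n a) / L \<or> \<omega> = real n * pi / L"
      using False assms(2) unfolding int unfolding band_eq[OF L A n] by auto
    then have "F \<omega> = (-1) ^ n * -1 \<or> F \<omega> = (-1) ^ n"
    proof
      assume "\<omega> = (real n * pi - edge n a) / L"
      then show ?thesis using arg_cong[OF signed_kp_edge[OF n a_pos], of "\<lambda>x. (-1) ^ n * x"] L
        by (simp flip: mult.assoc power_mult_distrib)
    next
      assume "\<omega> = real n * pi / L"
      then show ?thesis using arg_cong[OF signed_kp_npi[OF n a_pos], of "\<lambda>x. (-1) ^ n * x"] L
        by (simp flip: mult.assoc power_mult_distrib)
    qed
    then have F1: "(F \<omega>)\<^sup>2 = 1" by (auto simp: power_mult_distrib simp flip: power_mult)
    let ?W = "at \<omega> within interior B"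
    \<comment> \<open>An edge is a limit point of the open band, so \<open>Lim\<close> there picks
      out the limit; the bound tends to 0, hence the group velocity vanishes at the edges.\<close>
    have nt: "?W \<noteq> bot"
    proof -
      have "\<omega> \<in> closure (interior B)"
        unfolding int using ne assms(2) unfolding band_eq[OF L A n] by (simp add: closure_greaterThanLessThan)
      then show ?thesis using False by (simp add: closure_def trivial_limit_within)
    qed
    have "isCont (\<lambda>x. F x) \<omega>"
    proof -
      have "isCont (kp a) (\<omega> * L)"
        using has_real_derivative_kp[of "\<omega> * L" a] band_pos[OF assms(2)] L by (simp add: DERIV_isCont)
      moreover have "isCont (\<lambda>x. x * L) \<omega>" by (intro continuous_intros)
      ultimately show ?thesis by (rule isCont_o2[rotated])
    qed
    then have Flim: "((\<lambda>x. F x) \<longlongrightarrow> F \<omega>) ?W"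
      using continuous_at_imp_continuous_at_within by (simp add: continuous_within)
    have "((\<lambda>x. sqrt (1 - (F x)\<^sup>2) * c) \<longlongrightarrow> sqrt (1 - (F \<omega>)\<^sup>2) * c) ?W"
      by (intro tendsto_intros Flim)
    then have "((\<lambda>x. sqrt (1 - (F x)\<^sup>2) * c) \<longlongrightarrow> 0) ?W" unfolding F1 by simp
    then have "((\<lambda>x. complex_of_real L / dispersion_deriv k x) \<longlongrightarrow> 0) ?W"
      by (rule Lim_null_comparison[rotated]) (use le in \<open>simp add: eventually_at_filter\<close>)
    then have "group_velocity L k B \<omega> = 0"
      using False nt by (auto simp: group_velocity_def intro: tendsto_Lim)
    then show "cmod (group_velocity L k B \<omega>) \<le> c" using c by simp
  qed
qed

text \<open>Either U_N is at least 1/2, which gives the 1 / A term, or F is compared with a root and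
  the distance to the corresponding transparency point gives the 1 / D term.\<close>

lemma transmission_away_le:
  assumes "a \<ge> 2 * real n * pi" "N \<ge> 1" "\<omega> \<in> B" "D > 0"
    and away: "\<And>p. p \<in> transparency_points k B N \<Longrightarrow> \<bar>\<omega> - p\<bar> > D / A\<^sup>2"
  shows "cmod (transmission A L N \<omega>)
    \<le> (4 * real n * pi / L + 16 * (real n * pi)\<^sup>2 / L ^ 3) * (1 / A + 1 / D)"
proof -
  have npi: "real n > 0" "real n * pi > 0" using n by auto
  have y: "-1 \<le> F \<omega>" "F \<omega> \<le> 1" using abs_half_trace_le[OF assms(3)] by (auto simp: abs_le_iff)
  consider "1 / 2 \<le> \<bar>cheb_U N (F \<omega>)\<bar>"
    | j where "j \<in> {1..<N}" "\<bar>F \<omega> - cos (real j * pi / real N)\<bar> / 2 \<le> \<bar>cheb_U N (F \<omega>)\<bar>"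
    using abs_cheb_U_ge[OF y \<open>N \<ge> 1\<close>] by blast
  then show ?thesis
  proof cases
    case 1
    have "cmod (transmission A L N \<omega>) \<le> 2 * (real n * pi / L) / (A * (1 / 2))"
      by (rule cmod_transmission_le[OF assms(3,2) _ 1]) simp
    also have "\<dots> = 4 * real n * pi / L * (1 / A)" by simp
    also have "\<dots> \<le> (4 * real n * pi / L + 16 * (real n * pi)\<^sup>2 / L ^ 3) * (1 / A + 1 / D)"
      using L A \<open>D > 0\<close> npi by (intro mult_mono) auto
    finally show ?thesis .
  next
    case 2
    obtain p where p: "p \<in> transparency_points k B N" "F p = cos (real j * pi / real N)"
      using cheb_U_root_iff[OF \<open>N \<ge> 1\<close>, of "cos (real j * pi / real N)"] 2(1)
        transparency_point_exists[OF \<open>N \<ge> 1\<close>] by blast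
    have pB: "p \<in> B" using p(1) by (simp add: transparency_points_def)
    \<comment> \<open>Half of the gap in F that the slope bound A L^2 / (4 n pi) guarantees at
      distance D / A^2.\<close>
    define u where "u = L\<^sup>2 * D / (8 * real n * pi * A)"
    have u: "u > 0" unfolding u_def
      using L A \<open>D > 0\<close> npi by (intro divide_pos_pos mult_pos_pos) auto
    have "2 * u = A * L\<^sup>2 / (4 * real n * pi) * (D / A\<^sup>2)"
      using A npi by (simp add: u_def power2_eq_square field_simps)
    also have "\<dots> \<le> A * L\<^sup>2 / (4 * real n * pi) * \<bar>\<omega> - p\<bar>"
      using away[OF p(1)] A L by (intro mult_left_mono) auto
    also have "\<dots> \<le> \<bar>F \<omega> - F p\<bar>" by (rule half_trace_expanding[OF assms(1,3) pB])
    finally have "u \<le> \<bar>cheb_U N (F \<omega>)\<bar>" using 2(2) p(2) by simp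
    from cmod_transmission_le[OF assms(3,2) u this]
    have "cmod (transmission A L N \<omega>) \<le> 2 * (real n * pi / L) / (A * u)" .
    also have "\<dots> = 16 * (real n * pi)\<^sup>2 / L ^ 3 * (1 / D)"
      using A L npi \<open>D > 0\<close> by (simp add: u_def power2_eq_square power3_eq_cube field_simps)
    also have "\<dots> \<le> (4 * real n * pi / L + 16 * (real n * pi)\<^sup>2 / L ^ 3) * (1 / A + 1 / D)"
      using L A \<open>D > 0\<close> npi by (intro mult_mono) auto
    finally show ?thesis .
  qed
qed

lemma band_point_eq:
  "band_point B s * L = real n * pi - (1 - s) * edge n a"
  and band_point_in_band: "0 \<le> s \<Longrightarrow> s \<le> 1 \<Longrightarrow> band_point B s \<in> B"
proof -
  have "(real n * pi - edge n a) / L \<le> real n * pi / L"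
    using edge(1)[OF n a_pos] L by (simp add: divide_right_mono)
  then have "band_point B s = (real n * pi - edge n a) / L + s * (real n * pi / L - (real n * pi - edge n a) / L)"
    unfolding band_point_def band_eq[OF L A n] by simp
  then show eq: "band_point B s * L = real n * pi - (1 - s) * edge n a"
    using L by (simp add: field_simps)
  assume s: "0 \<le> s" "s \<le> 1"
  then have "0 \<le> (1 - s) * edge n a" "(1 - s) * edge n a \<le> 1 * edge n a"
    using edge(1)[OF n a_pos] by (auto intro!: mult_right_mono)
  then show "band_point B s \<in> B" unfolding band_iff eq by simp
qed

lemma half_trace_band_point:
  assumes "a \<ge> 2 * real n * pi" "0 \<le> s" "s \<le> 1"
  shows "\<bar>F (band_point B s) - (-1) ^ n * (2 * s - 1)\<bar>
    \<le> (8 * (real n * pi)\<^sup>2 + 10 * (real n * pi)) / a"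
proof -
  have "\<bar>F (band_point B s) - (-1) ^ n * (2 * s - 1)\<bar>
    = \<bar>(-1) ^ n * (F (band_point B s) - (-1) ^ n * (2 * s - 1))\<bar>" by (simp add: abs_mult)
  also have "(-1) ^ n * (F (band_point B s) - (-1) ^ n * (2 * s - 1))
    = (-1) ^ n * F (band_point B s) - (1 - 2 * (1 - s))"
    by (simp add: right_diff_distrib flip: mult.assoc power_mult_distrib)
  finally show ?thesis
    using signed_kp_at_relative_position[OF n a_pos assms(1), of "1 - s"] assms(2,3)
    unfolding band_point_eq by simp
qed

end

section \<open>Asymptotics for large coupling\<close>

lemma band_asymptotics:
  assumes L: "L > 0" and n: "n \<ge> 1"
  shows "\<exists>e. e \<in> O[at_top](\<lambda>A. 1 / A\<^sup>2) \<and>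
    (\<forall>A>0. band A L n = {real n * pi / L * (1 - 4 / (A * L) + e A) .. real n * pi / L})"
proof (intro exI conjI allI impI)
  \<comment> \<open>Chosen so that the formula for the band is an identity for every A > 0; only its
    size is asymptotic.\<close>
  define e where "e A = 4 / (A * L) - edge n (A * L / 2) / (real n * pi)" for A
  have npi: "real n * pi > 0" using n by simp
  define C where "C = 2 * (real n * pi)\<^sup>2 + 2 * (real n * pi)"
  have bound: "\<bar>e A\<bar> \<le> 8 * C / (real n * pi * L\<^sup>2) * \<bar>1 / A\<^sup>2\<bar>" if A: "A > 0" for A
  proof -
    define a where "a = A * L / 2"
    have a: "a > 0" using A L by (simp add: a_def)
    have "4 / (A * L) = 2 / a" using A L by (simp add: a_def)
    then have "e A = 2 / a - edge n a / (real n * pi)" by (simp add: e_def a_def)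
    then have "e A = - (2 / (a * (real n * pi)) * (a * edge n a / 2 - real n * pi))"
      using a n by (simp add: right_diff_distrib)
    then have "\<bar>e A\<bar> = \<bar>2 / (a * (real n * pi))\<bar> * \<bar>a * edge n a / 2 - real n * pi\<bar>"
      by (simp only: abs_minus_cancel abs_mult)
    also have "\<bar>2 / (a * (real n * pi))\<bar> = 2 / (a * (real n * pi))" using a npi by simp
    also have "2 / (a * (real n * pi)) * \<bar>a * edge n a / 2 - real n * pi\<bar>
        \<le> 2 / (a * (real n * pi)) * (C / a)"
      using edge_asymp[OF n a] a npi unfolding C_def by (intro mult_left_mono) auto
    also have "\<dots> = 8 * C / (real n * pi * L\<^sup>2) * \<bar>1 / A\<^sup>2\<bar>"
      by (simp add: a_def power2_eq_square)
    finally show ?thesis .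
  qed
  have "\<forall>\<^sub>F A in at_top. norm (e A) \<le> 8 * C / (real n * pi * L\<^sup>2) * norm (1 / A\<^sup>2)"
    unfolding real_norm_def by (rule eventually_mono[OF eventually_gt_at_top[of 0] bound])
  then show "e \<in> O[at_top](\<lambda>A. 1 / A\<^sup>2)" by (rule bigoI)
  fix A :: real assume A: "A > 0"
  have "real n * pi / L * (1 - 4 / (A * L) + e A) = (real n * pi - edge n (A * L / 2)) / L"
    using n L by (simp add: e_def field_simps)
  then show "band A L n = {real n * pi / L * (1 - 4 / (A * L) + e A) .. real n * pi / L}"
    by (simp only: band_eq[OF L A n])
qed

lemma group_velocity_asymptotics:
  fixes k :: "real \<Rightarrow> complex \<Rightarrow> complex"
  assumes L: "L > 0" and dr: "\<And>A. A > 0 \<Longrightarrow> dispersion_relation A L (k A)" and n: "n \<ge> 1"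
  shows "\<exists>e. e \<in> O[at_top](\<lambda>A. 1 / A) \<and>
        (\<forall>\<^sub>F A in at_top.
          (\<forall>\<omega>\<in>interior (band A L n).
             (\<lambda>x. k A (complex_of_real x)) differentiable (at \<omega>) \<and> dispersion_deriv (k A) \<omega> \<noteq> 0) \<and>
          (\<forall>\<omega>\<in>band A L n.
             cmod (group_velocity L (k A) (band A L n) \<omega>)
               \<le> 2 * real n * pi / (A * L) * (1 + e A)))"
proof (intro exI conjI)
  \<comment> \<open>The exact excess of the bound n pi / (a cos edge) over its leading term 2 n pi /
    (A L).\<close>
  define e where "e A = 1 / cos (edge n (A * L / 2)) - 1" for A
  have ev: "\<forall>\<^sub>F A in at_top. A > 0 \<and> A * L / 2 \<ge> 2 * real n * pi"
    using eventually_ge_at_top[of "4 * real n * pi / L"] eventually_gt_at_top[of 0]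
    by eventually_elim (use L in \<open>simp add: field_simps\<close>)
  have bound: "\<bar>e A\<bar> \<le> 4 * real n * pi / L * \<bar>1 / A\<bar>" if A: "A > 0" "A * L / 2 \<ge> 2 * real n * pi" for A
  proof -
    define a where "a = A * L / 2"
    have a: "a > 0" "a \<ge> 2 * real n * pi" using A L by (simp_all add: a_def)
    define d where "d = edge n a"
    have d: "0 < d" "d \<le> 1" "1 / 2 \<le> cos d" "d \<le> 2 * real n * pi / a"
      using edge[OF n a(1)] kp_deriv_ge[OF n a(1) order_refl _ a(2)] edge_le[OF n a(1)]
      by (auto simp: d_def)
    have "e A = (1 - cos d) / cos d" using d by (simp add: e_def d_def a_def diff_divide_distrib)
    then have "\<bar>e A\<bar> = (1 - cos d) / cos d" using d by simp
    also have "\<dots> \<le> (1 - cos d) / (1 / 2)" using d by (intro divide_left_mono) auto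
    also have "\<dots> \<le> d\<^sup>2" using one_minus_cos_le[of d] by simp
    also have "\<dots> \<le> d" using d mult_left_mono[of d 1 d] by (simp add: power2_eq_square)
    also have "\<dots> \<le> 2 * real n * pi / a" by (rule d)
    also have "\<dots> = 4 * real n * pi / L * \<bar>1 / A\<bar>" using A by (simp add: a_def mult_ac)
    finally show ?thesis .
  qed
  have "\<forall>\<^sub>F A in at_top. norm (e A) \<le> 4 * real n * pi / L * norm (1 / A)"
    unfolding real_norm_def by (rule eventually_mono[OF ev]) (use bound in blast)
  then show "e \<in> O[at_top](\<lambda>A. 1 / A)" by (rule bigoI)
  show "\<forall>\<^sub>F A in at_top.
          (\<forall>\<omega>\<in>interior (band A L n).
             (\<lambda>x. k A (complex_of_real x)) differentiable (at \<omega>) \<and> dispersion_deriv (k A) \<omega> \<noteq> 0) \<and>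
          (\<forall>\<omega>\<in>band A L n.
             cmod (group_velocity L (k A) (band A L n) \<omega>)
               \<le> 2 * real n * pi / (A * L) * (1 + e A))"
    using ev
  proof eventually_elim
    case (elim A)
    then have A: "A > 0" "A * L / 2 \<ge> 2 * real n * pi" by auto
    note ctx = dr[OF A(1)] L A(1) n
    have "dispersion_deriv (k A) \<omega> \<noteq> 0" if "\<omega> \<in> interior (band A L n)" for \<omega>
      unfolding dispersion_differentiable(2)[OF ctx that]
      using dispersion_differentiable(3)[OF ctx that] sin_dispersion_neq_0[OF ctx that] L by simp
    moreover have "real n * pi / (A * L / 2 * cos (edge n (A * L / 2))) = 2 * real n * pi / (A * L) * (1 + e A)"
      by (simp add: e_def)
    ultimately show ?case
      using dispersion_differentiable(1)[OF ctx] group_velocity_le[OF ctx A(2)] by metis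
  qed
qed

text \<open>Let \<open>y\<close> be the limit of F at relative position s. If U_N(y) = 0, the
  transparency point p with F(p) = y lies within order A^-2, as the error 1 / A in F is divided by a
  slope of order A. Otherwise U_N stays away from 0.\<close>

lemma transmission_at_band_point:
  fixes k :: "real \<Rightarrow> complex \<Rightarrow> complex"
  assumes L: "L > 0" and dr: "\<And>A. A > 0 \<Longrightarrow> dispersion_relation A L (k A)"
    and n: "n \<ge> 1" and N: "N \<ge> 1"
  shows "\<exists>D. \<forall>s\<in>{0..1}.
          (\<forall>\<^sub>F A in at_top. \<exists>p\<in>transparency_points (k A) (band A L n) N.
             \<bar>band_point (band A L n) s - p\<bar> \<le> D / A\<^sup>2) \<or>
          (\<lambda>A. cmod (transmission A L N (band_point (band A L n) s))) \<in> O[at_top](\<lambda>A. 1 / A)"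
proof (intro exI ballI)
  define K where "K = 8 * (real n * pi)\<^sup>2 + 10 * (real n * pi)"
  \<comment> \<open>The error 2 K / (A L) of F divided by the slope bound A L^2 / (4 n pi); it does
    not depend on s.\<close>
  define D where "D = 8 * real n * pi * K / L ^ 3"
  have npi: "real n > 0" "real n * pi > 0" using n by auto
  have ev: "\<forall>\<^sub>F A in at_top. A > 0 \<and> A * L / 2 \<ge> 2 * real n * pi"
    using eventually_ge_at_top[of "4 * real n * pi / L"] eventually_gt_at_top[of 0]
    by eventually_elim (use L in \<open>simp add: field_simps\<close>)
  fix s :: real assume s: "s \<in> {0..1}"
  define y where "y = (-1) ^ n * (2 * s - 1)"
  have "\<bar>y\<bar> \<le> 1" using s by (auto simp: y_def abs_mult)
  then have y: "-1 \<le> y" "y \<le> 1" by (auto simp: abs_le_iff)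
  define bp where "bp A = band_point (band A L n) s" for A
  define f where "f A = kp (A * L / 2) (bp A * L)" for A
  have f: "\<bar>f A - y\<bar> \<le> K / (A * L / 2)" if "A > 0" "A * L / 2 \<ge> 2 * real n * pi" for A
    using half_trace_band_point[OF dr[OF that(1)] L that(1) n that(2), of s] s
    by (simp add: f_def bp_def y_def K_def)
  have bp: "bp A \<in> band A L n" if "A > 0" for A
    using band_point_in_band[OF dr[OF that] L that n, of s] s by (simp add: bp_def)
  show "(\<forall>\<^sub>F A in at_top. \<exists>p\<in>transparency_points (k A) (band A L n) N.
             \<bar>band_point (band A L n) s - p\<bar> \<le> D / A\<^sup>2) \<or>
          (\<lambda>A. cmod (transmission A L N (band_point (band A L n) s))) \<in> O[at_top](\<lambda>A. 1 / A)"
    unfolding bp_def[symmetric]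
  proof (cases "cheb_U N y = 0")
    case True
    have "\<forall>\<^sub>F A in at_top. \<exists>p\<in>transparency_points (k A) (band A L n) N. \<bar>bp A - p\<bar> \<le> D / A\<^sup>2"
      using ev
    proof eventually_elim
      case (elim A)
      then have A: "A > 0" "A * L / 2 \<ge> 2 * real n * pi" by auto
      note ctx = dr[OF A(1)] L A(1) n
      obtain p where p: "p \<in> transparency_points (k A) (band A L n) N" "kp (A * L / 2) (p * L) = y"
        by (rule transparency_point_exists[OF ctx N y True])
      have "p \<in> band A L n" using p(1) by (simp add: transparency_points_def)
      from half_trace_expanding[OF ctx A(2) bp[OF A(1)] this]
      have "A * L\<^sup>2 / (4 * real n * pi) * \<bar>bp A - p\<bar> \<le> \<bar>f A - y\<bar>" by (simp add: f_def p(2))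
      also have "\<dots> \<le> K / (A * L / 2)" by (rule f[OF A])
      also have "\<dots> = A * L\<^sup>2 / (4 * real n * pi) * (D / A\<^sup>2)"
        using A L npi by (simp add: D_def field_simps power2_eq_square power3_eq_cube)
      finally have "\<bar>bp A - p\<bar> \<le> D / A\<^sup>2"
        by (rule mult_left_le_imp_le) (use A L npi in auto)
      with p(1) show ?case by blast
    qed
    then show "(\<forall>\<^sub>F A in at_top. \<exists>p\<in>transparency_points (k A) (band A L n) N. \<bar>bp A - p\<bar> \<le> D / A\<^sup>2)
      \<or> (\<lambda>A. cmod (transmission A L N (bp A))) \<in> O[at_top](\<lambda>A. 1 / A)" ..
  next
    case False
    define u where "u = \<bar>cheb_U N y\<bar> / 2"
    have u: "u > 0" using False by (simp add: u_def)
    have "((\<lambda>A. f A - y) \<longlongrightarrow> 0) at_top"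
    proof (rule Lim_null_comparison)
      show "\<forall>\<^sub>F A in at_top. norm (f A - y) \<le> 2 * K / L * inverse A"
        using ev
      proof eventually_elim
        case (elim A)
        then have "norm (f A - y) \<le> K / (A * L / 2)" using f by simp
        also have "\<dots> = 2 * K / L * inverse A" by (simp add: field_simps)
        finally show ?case .
      qed
      show "((\<lambda>A. 2 * K / L * inverse A) \<longlongrightarrow> 0) at_top"
        by (intro tendsto_mult_right_zero tendsto_inverse_0_at_top filterlim_ident)
    qed
    then have "(f \<longlongrightarrow> y) at_top" by (rule LIM_zero_cancel)
    moreover have "continuous_on UNIV (\<lambda>x::real. cheb_U N x)" by (intro continuous_intros)
    then have "isCont (\<lambda>x::real. cheb_U N x) y" by (simp add: continuous_on_eq_continuous_at)
    ultimately have "((\<lambda>A. cheb_U N (f A)) \<longlongrightarrow> cheb_U N y) at_top"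
      by (rule isCont_tendsto_compose[rotated])
    then have "((\<lambda>A. \<bar>cheb_U N (f A)\<bar>) \<longlongrightarrow> \<bar>cheb_U N y\<bar>) at_top" by (rule tendsto_rabs)
    then have "\<forall>\<^sub>F A in at_top. u < \<bar>cheb_U N (f A)\<bar>"
      by (rule order_tendstoD(1)) (use False in \<open>simp add: u_def\<close>)
    with ev have "\<forall>\<^sub>F A in at_top. norm (cmod (transmission A L N (bp A)))
      \<le> 2 * (real n * pi / L) / u * norm (1 / A)"
    proof eventually_elim
      case (elim A)
      then have A: "A > 0" "u \<le> \<bar>cheb_U N (f A)\<bar>" by auto
      have "cmod (transmission A L N (bp A)) \<le> 2 * (real n * pi / L) / (A * u)"
        using cmod_transmission_le[OF dr[OF A(1)] L A(1) n bp[OF A(1)] N u] A(2) by (simp add: f_def)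
      also have "\<dots> = 2 * (real n * pi / L) / u * norm (1 / A)" using A by simp
      finally show ?case by simp
    qed
    then have "(\<lambda>A. cmod (transmission A L N (bp A))) \<in> O[at_top](\<lambda>A. 1 / A)" by (rule bigoI)
    then show "(\<forall>\<^sub>F A in at_top. \<exists>p\<in>transparency_points (k A) (band A L n) N. \<bar>bp A - p\<bar> \<le> D / A\<^sup>2)
      \<or> (\<lambda>A. cmod (transmission A L N (bp A))) \<in> O[at_top](\<lambda>A. 1 / A)" ..
  qed
qed

text \<open>Neither the constant nor the threshold for A involves D, so D may be chosen depending on
  A.\<close>

lemma transmission_away_from_transparency_points:
  fixes k :: "real \<Rightarrow> complex \<Rightarrow> complex"
  assumes L: "L > 0" and dr: "\<And>A. A > 0 \<Longrightarrow> dispersion_relation A L (k A)"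
    and n: "n \<ge> 1" and N: "N \<ge> 1"
  shows "\<exists>C. \<forall>\<^sub>F A in at_top. \<forall>D>0. \<forall>\<omega>\<in>band A L n.
          (\<forall>p\<in>transparency_points (k A) (band A L n) N. \<bar>\<omega> - p\<bar> > D / A\<^sup>2) \<longrightarrow>
          cmod (transmission A L N \<omega>) \<le> C * (1 / A + 1 / D)"
proof
  show "\<forall>\<^sub>F A in at_top. \<forall>D>0. \<forall>\<omega>\<in>band A L n.
          (\<forall>p\<in>transparency_points (k A) (band A L n) N. \<bar>\<omega> - p\<bar> > D / A\<^sup>2) \<longrightarrow>
          cmod (transmission A L N \<omega>)
            \<le> (4 * real n * pi / L + 16 * (real n * pi)\<^sup>2 / L ^ 3) * (1 / A + 1 / D)"
    using eventually_ge_at_top[of "4 * real n * pi / L"] eventually_gt_at_top[of 0]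
  proof eventually_elim
    case (elim A)
    then have "A * L / 2 \<ge> 2 * real n * pi" using L by (simp add: field_simps)
    then show ?case
      using transmission_away_le[OF dr[OF elim(2)] L elim(2) n _ N] by blast
  qed
qed

theorem theorem9:
  fixes L :: real and k :: "real \<Rightarrow> complex \<Rightarrow> complex"
  assumes L_pos: "L > 0"
    and dispersion: "\<And>A. A > 0 \<Longrightarrow> dispersion_relation A L (k A)"
  shows
    "(\<forall>n\<ge>1. \<exists>e. e \<in> O[at_top](\<lambda>A. 1 / A\<^sup>2) \<and>
        (\<forall>A>0. band A L n =
          {real n * pi / L * (1 - 4 / (A * L) + e A) .. real n * pi / L})) \<and>
     (\<forall>n\<ge>1. \<exists>e. e \<in> O[at_top](\<lambda>A. 1 / A) \<and>
        (\<forall>\<^sub>F A in at_top.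
          (\<forall>\<omega>\<in>interior (band A L n).
             (\<lambda>x. k A (complex_of_real x)) differentiable (at \<omega>) \<and> dispersion_deriv (k A) \<omega> \<noteq> 0) \<and>
          (\<forall>\<omega>\<in>band A L n.
             cmod (group_velocity L (k A) (band A L n) \<omega>)
               \<le> 2 * real n * pi / (A * L) * (1 + e A)))) \<and>
     (\<forall>n\<ge>1. \<forall>N\<ge>1.
        (\<forall>A>0.
          (\<forall>\<omega>\<in>band A L n.
             cmod (transmission A L N \<omega>) =
               1 / sqrt (1 + (cmod (complex_of_real (A / (2 * \<omega>)) *
                                    sin_ratio N (k A (complex_of_real \<omega>))))\<^sup>2)) \<and>
          finite (transparency_points (k A) (band A L n) N) \<and>
          card (transparency_points (k A) (band A L n) N) = N - 1) \<and>
        (\<exists>D. \<forall>s\<in>{0..1}.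
          (\<forall>\<^sub>F A in at_top. \<exists>p\<in>transparency_points (k A) (band A L n) N.
             \<bar>band_point (band A L n) s - p\<bar> \<le> D / A\<^sup>2) \<or>
          (\<lambda>A. cmod (transmission A L N (band_point (band A L n) s))) \<in> O[at_top](\<lambda>A. 1 / A)) \<and>
        (\<exists>C. \<forall>\<^sub>F A in at_top. \<forall>D>0. \<forall>\<omega>\<in>band A L n.
          (\<forall>p\<in>transparency_points (k A) (band A L n) N. \<bar>\<omega> - p\<bar> > D / A\<^sup>2) \<longrightarrow>
          cmod (transmission A L N \<omega>) \<le> C * (1 / A + 1 / D)))"
proof -
  have tr: "cmod (transmission A L N \<omega>) =
      1 / sqrt (1 + (cmod (complex_of_real (A / (2 * \<omega>)) * sin_ratio N (k A (complex_of_real \<omega>))))\<^sup>2)"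
    if "n \<ge> 1" "N \<ge> 1" "A > 0" "\<omega> \<in> band A L n" for n N A \<omega>
  proof -
    note ctx = dispersion[OF that(3)] L_pos that(3) that(1)
    show ?thesis
      unfolding sin_ratio_dispersion[OF ctx that(4)] cmod_transmission_band[OF ctx that(4,2)]
      by (simp only: norm_of_real power2_abs flip: of_real_mult)
  qed
  show ?thesis
    by (intro conjI allI impI ballI tr band_asymptotics[OF L_pos]
        group_velocity_asymptotics[OF L_pos dispersion]
        card_transparency_points[OF dispersion L_pos]
        transmission_at_band_point[OF L_pos dispersion]
        transmission_away_from_transparency_points[OF L_pos dispersion])
qed

end
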